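(* Let $K$ be a strictly convex domain in $\mathbb R^2$ whose boundary $\partial K$ is an oval, and let $S_K$ be the Steiner symmetral of $K$. Then $$\left|\widetilde{A}_{E_{1/2}(\partial K)}\right|\geqslant\max\left\{\pi d_\infty^2(K,S_K),\ 2d_2^2(K,S_K)\right\}.$$ Moreover, if $\partial K$ is not a curve of constant width and the Wigner caustic type curve associated with $\partial K$ is an oval, and $W_K$ denotes the convex body bounded by this curve, then $$\left|\widetilde{A}_{\mathrm{SMS}(\partial K)}\right|\geqslant\max\Big\{2\pi d_\infty^2(K,S_K)+\pi d_\infty^2(K,W_K),\ 2\pi d_\infty^2(K,S_K)+\tfrac32 d_2^2(K,W_K),$$ $$4d_2^2(K,S_K)+\pi d_\infty^2(K,W_K),\ 4d_2^2(K,S_K)+\tfrac32 d_2^2(K,W_K)\Big\}.$$ Here $\widetilde{A}_{E_{1/2}(\partial K)}$ and $\widetilde{A}_{\mathrm{SMS}(\partial K)}$ are the oriented areas of the Wigner caustic and of the Spherical Measure Set of $\partial K$.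
   Context: An oval is a $C^\infty$ regular simple closed convex planar curve (signed curvature nowhere zero, of constant sign); orient ovals positively. It is of constant width if the distance between parallel tangent lines is constant. For an oval $M$ of length $L_M$ with an origin inside and Minkowski support function $p_M(\theta)$, $M$ is parameterized by $\gamma(\theta)=(p_M\cos\theta-p_M'\sin\theta,\ p_M\sin\theta+p_M'\cos\theta)$, with unit normal $\mathbf n(\gamma(\theta))=-(\cos\theta,\sin\theta)$. Parallel pairs (pairs of distinct points with parallel tangent lines) are $\gamma(\theta),\gamma(\theta+\pi)$. Wigner caustic: $E_{1/2}(M)=\{\frac12(a+b): a,b\text{ a parallel pair of }M\}$, parameterized by $\frac12(\gamma(\theta)+\gamma(\theta+\pi))$ and traversed once, $\theta\in[0,\pi]$. Spherical Measure Set: $\mathrm{SMS}(M)=\{a+\frac{L_M}{2\pi}\mathbf n(a):a\in M\}$, parameterized by $\gamma(\theta)+\frac{L_M}{2\pi}\mathbf n(\gamma(\theta))$, $\theta\in[0,2\pi]$, when $M$ is not of constant width. The oriented area of an oriented closed curve $C$ is $\widetilde A_C=\frac12\int_C -y\,dx+x\,dy$ (zero if $C$ is a point). The Wigner caustic type curve associated with $M$ is the curve with support function $\frac{L_M}{2\pi}+\frac{p_M(\theta)-p_M(\theta+\pi)}{2}$. The Steiner point of $K$ is $\vec s(K)=\frac1\pi\int_0^{2\pi}(\cos\theta,\sin\theta)p_{\partial K}(\theta)d\theta$. The Steiner symmetral $S_K$ is $\frac12(K+(-K))$ (Minkowski addition, $-K=\{-k:k\in K\}$), translated so that its center is the Steiner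 point of $K$; its support function is $\langle\vec s(K),(\cos\theta,\sin\theta)\rangle+\frac12(p_{\partial K}(\theta)+p_{\partial K}(\theta+\pi))$. $d_\infty(K,N)=\max_\theta|p_{\partial K}(\theta)-p_{\partial N}(\theta)|$ and $d_2(K,N)=\left(\int_0^{2\pi}|p_{\partial K}(\theta)-p_{\partial N}(\theta)|^2d\theta\right)^{1/2}$. *)

theory Defs
  imports "HOL-Analysis.Analysis" "HOL-Library.Set_Algebras"
begin

type_synonym plane = "real \<times> real"

definition det2 :: "plane \<Rightarrow> plane \<Rightarrow> real" where
  "det2 v w = fst v * snd w - snd v * fst w"

abbreviation curve_deriv :: "(real \<Rightarrow> plane) \<Rightarrow> real \<Rightarrow> plane" where
  "curve_deriv g \<equiv> (\<lambda>t. vector_derivative g (at t))"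

definition smooth_curve :: "(real \<Rightarrow> plane) \<Rightarrow> bool" where
  "smooth_curve g \<longleftrightarrow> (\<forall>k t. (curve_deriv ^^ k) g differentiable (at t))"

definition signed_curvature :: "(real \<Rightarrow> plane) \<Rightarrow> real \<Rightarrow> real" where
  "signed_curvature g t =
     det2 (curve_deriv g t) (curve_deriv (curve_deriv g) t) / norm (curve_deriv g t) ^ 3"

definition tangent_line :: "(real \<Rightarrow> plane) \<Rightarrow> real \<Rightarrow> plane set" where
  "tangent_line g t = range (\<lambda>s. g t + s *\<^sub>R curve_deriv g t)"

text \<open>A closed curve is convex if it lies on one side of each of its tangent lines.\<close>

definition convex_curve :: "(real \<Rightarrow> plane) \<Rightarrow> bool" where
  "convex_curve g \<longleftrightarrow>
     (\<forall>t. (\<forall>s. det2 (curve_deriv g t) (g s - g t) \<ge> 0) \<or>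
          (\<forall>s. det2 (curve_deriv g t) (g s - g t) \<le> 0))"

text \<open>Closed curves are maps on the whole real line that are periodic with period \<open>T\<close>,
  so that smoothness also holds at the closing point.\<close>

definition oval_param :: "(real \<Rightarrow> plane) \<Rightarrow> real \<Rightarrow> bool" where
  "oval_param g T \<longleftrightarrow>
     T > 0 \<and> smooth_curve g \<and> (\<forall>t. g (t + T) = g t) \<and> inj_on g {0..<T} \<and>
     (\<forall>t. curve_deriv g t \<noteq> 0) \<and> convex_curve g \<and>
     ((\<forall>t. signed_curvature g t > 0) \<or> (\<forall>t. signed_curvature g t < 0))"

definition oval :: "plane set \<Rightarrow> bool" where
  "oval M \<longleftrightarrow> (\<exists>g T. oval_param g T \<and> M = range g)"

text \<open>Arc length does not depend on the parametrization, so the description is definite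
  for every oval.\<close>

definition oval_length :: "plane set \<Rightarrow> real" where
  "oval_length M =
     (THE L. \<exists>g T. oval_param g T \<and> M = range g \<and>
                   L = integral {0..T} (\<lambda>t. norm (curve_deriv g t)))"

definition constant_width :: "plane set \<Rightarrow> bool" where
  "constant_width M \<longleftrightarrow>
     (\<exists>d. \<forall>g T s t. oval_param g T \<and> M = range g \<and> g s \<noteq> g t \<and>
            det2 (curve_deriv g s) (curve_deriv g t) = 0 \<longrightarrow>
            setdist (tangent_line g s) (tangent_line g t) = d)"

definition unit_dir :: "real \<Rightarrow> plane" where
  "unit_dir \<theta> = (cos \<theta>, sin \<theta>)"

text \<open>For an oval the supremum is the signed distance from the origin to the tangent line with
  outer normal \<open>unit_dir \<theta>\<close>. The origin need not lie inside.\<close>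

definition support_fun :: "plane set \<Rightarrow> real \<Rightarrow> real" where
  "support_fun M \<theta> = (SUP x\<in>M. x \<bullet> unit_dir \<theta>)"

definition support_curve :: "(real \<Rightarrow> real) \<Rightarrow> real \<Rightarrow> plane" where
  "support_curve p \<theta> =
     (p \<theta> * cos \<theta> - deriv p \<theta> * sin \<theta>, p \<theta> * sin \<theta> + deriv p \<theta> * cos \<theta>)"

definition oval_curve :: "plane set \<Rightarrow> real \<Rightarrow> plane" where
  "oval_curve M = support_curve (support_fun M)"

definition oriented_area :: "(real \<Rightarrow> plane) \<Rightarrow> real \<Rightarrow> real \<Rightarrow> real" where
  "oriented_area c a b =
     (1/2) * integral {a..b} (\<lambda>t. - snd (c t) * fst (curve_deriv c t)
                                  + fst (c t) * snd (curve_deriv c t))"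

text \<open>The points \<open>oval_curve M \<theta>\<close> and \<open>oval_curve M (\<theta> + pi)\<close> run through the
  parallel pairs of \<open>M\<close>; hence this curve is traversed once for \<open>\<theta> \<in> {0..pi}\<close>.\<close>

definition wigner_caustic :: "plane set \<Rightarrow> real \<Rightarrow> plane" where
  "wigner_caustic M \<theta> = (1/2) *\<^sub>R (oval_curve M \<theta> + oval_curve M (\<theta> + pi))"

definition wigner_caustic_area :: "plane set \<Rightarrow> real" where
  "wigner_caustic_area M = oriented_area (wigner_caustic M) 0 pi"

text \<open>The unit normal of the positively oriented oval points inwards: it is \<open>- unit_dir \<theta>\<close>.\<close>

definition spherical_measure_set :: "plane set \<Rightarrow> real \<Rightarrow> plane" where
  "spherical_measure_set M \<theta> =
     oval_curve M \<theta> + (oval_length M / (2 * pi)) *\<^sub>R (- unit_dir \<theta>)"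

definition sms_area :: "plane set \<Rightarrow> real" where
  "sms_area M = oriented_area (spherical_measure_set M) 0 (2 * pi)"

definition wigner_type_curve :: "plane set \<Rightarrow> real \<Rightarrow> plane" where
  "wigner_type_curve M =
     support_curve (\<lambda>\<theta>. oval_length M / (2 * pi)
                          + (support_fun M \<theta> - support_fun M (\<theta> + pi)) / 2)"

text \<open>No closedness is required, so that both the open domain and its closure are covered.\<close>

definition strictly_convex_domain :: "plane set \<Rightarrow> bool" where
  "strictly_convex_domain K \<longleftrightarrow>
     bounded K \<and> interior K \<noteq> {} \<and>
     (\<forall>x\<in>closure K. \<forall>y\<in>closure K. x \<noteq> y \<longrightarrow> open_segment x y \<subseteq> interior K)"

definition convex_body :: "plane set \<Rightarrow> bool" where
  "convex_body W \<longleftrightarrow> compact W \<and> convex W \<and> interior W \<noteq> {}"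

definition steiner_point :: "plane set \<Rightarrow> plane" where
  "steiner_point K =
     (1 / pi) *\<^sub>R integral {0..2 * pi} (\<lambda>\<theta>. support_fun (frontier K) \<theta> *\<^sub>R unit_dir \<theta>)"

text \<open>The symmetral \<open>(K + (-K)) / 2\<close> (Minkowski sum) is centred at the origin before the
  translation.\<close>

definition steiner_symmetral :: "plane set \<Rightarrow> plane set" where
  "steiner_symmetral K =
     (\<lambda>z. steiner_point K + z) ` ((\<lambda>z. (1/2) *\<^sub>R z) ` (K + uminus ` K))"

definition dist_inf :: "plane set \<Rightarrow> plane set \<Rightarrow> real" where
  "dist_inf K N =
     (SUP \<theta>\<in>{0..2 * pi}. \<bar>support_fun (frontier K) \<theta> - support_fun (frontier N) \<theta>\<bar>)"

definition dist_2 :: "plane set \<Rightarrow> plane set \<Rightarrow> real" where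
  "dist_2 K N =
     sqrt (integral {0..2 * pi}
       (\<lambda>\<theta>. \<bar>support_fun (frontier K) \<theta> - support_fun (frontier N) \<theta>\<bar>\<^sup>2))"

end

theory Submission
  imports Defs
begin

text \<open>
  Write \<open>p\<close> for the support function of \<open>M = \<partial>K\<close>, \<open>L\<close> for its length and \<open>s\<close> for the first
  harmonic \<open>\<theta> \<mapsto> \<langle>s(K), u(\<theta>)\<rangle>\<close>, with \<open>u(\<theta>) = (cos \<theta>, sin \<theta>)\<close>. The map \<open>\<theta> \<mapsto> \<theta> + \<pi>\<close> splits
  \<open>p = f + s + g + L/2\<pi>\<close>, where \<open>f\<close> has only odd frequencies \<open>n \<ge> 3\<close> and \<open>g\<close> only even
  frequencies \<open>n \<ge> 2\<close>; the mean of \<open>p\<close> is \<open>L/2\<pi>\<close> by Cauchy's length formula. Everything in the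
  claim is expressed by \<open>f\<close> and \<open>g\<close>: the support functions of \<open>S\<^sub>K\<close> and \<open>W\<^sub>K\<close> are \<open>p - f\<close> and
  \<open>p - g\<close>, so that \<open>f\<close> and \<open>g\<close> are what the distances measure; and since the oriented area of a
  curve with support function \<open>q\<close> is \<open>\<integral> q (q + q'') / 2\<close>, the two areas are \<open>- E(f) / 4\<close> and
  \<open>- (E(f) + E(g)) / 2\<close> with the energy \<open>E(h) = \<integral> h'\<^sup>2 - h\<^sup>2\<close> over a period. Translations (the
  term \<open>s\<close>) do not contribute, and neither do the products of odd and even parts.

  It remains to bound a function by its energy. If \<open>h\<close> has only frequencies \<open>n \<ge> c\<close> of the parity
  of \<open>c\<close> and \<open>\<rho>\<^sub>n\<^sup>2\<close> is the sum of the squares of its two Fourier coefficients of frequency \<open>n\<close>, then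
  \<open>E(h) = \<pi> \<Sum> (n\<^sup>2 - 1) \<rho>\<^sub>n\<^sup>2\<close>. This gives \<open>(c\<^sup>2 - 1) \<integral> h\<^sup>2 \<le> E(h)\<close>, and the Cauchy-Schwarz
  inequality with the telescoping sum \<open>\<Sum> 1 / (n\<^sup>2 - 1) = 1 / (2 (c - 1))\<close> gives
  \<open>2 \<pi> (c - 1) (max \<bar>h\<bar>)\<^sup>2 \<le> E(h)\<close>. The theorem uses \<open>c = 3\<close> for \<open>f\<close> and \<open>c = 2\<close> for \<open>g\<close>. Only
  finite sums are manipulated: \<open>trig_sum_inequalities\<close> treats trigonometric polynomials, and
  \<open>C1_trig_approx\<close> approximates \<open>h\<close> and \<open>h'\<close> uniformly by polynomials whose
  frequencies obey the same restriction, starting from the Stone-Weierstrass theorem on the circle.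

  The geometric input is that the support function of an oval is of class \<open>C\<^sup>2\<close> with integral \<open>L\<close>
  (\<open>oval_support_fun\<close>), and that a curve parametrized by its support function really has that
  support function (\<open>support_fun_support_curve\<close>). For the former an oval is reparametrized by
  the angle of its normal; convexity, curvature and injectivity together force this angle to grow
  by exactly \<open>2\<pi>\<close> over a period.
\<close>

section \<open>Calculus of periodic functions\<close>

lemma derivative_shift:
  fixes f f' :: "real \<Rightarrow> real"
  assumes "\<And>x. (f has_real_derivative f' x) (at x)" "\<And>x. f (x + d) = k * f x"
  shows "f' (x + d) = k * f' x"
proof -
  have "((\<lambda>y. f (y + d)) has_real_derivative f' (x + d) * 1) (at x)"
    by (intro DERIV_chain2[OF assms(1)]) (auto intro!: derivative_eq_intros)
  moreover have "((\<lambda>y. f (y + d)) has_real_derivative k * f' x) (at x)"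
    unfolding assms(2) by (intro DERIV_cmult assms(1))
  ultimately show ?thesis using DERIV_unique by fastforce
qed

lemma has_integral_derivative:
  fixes F h :: "real \<Rightarrow> real"
  assumes "\<And>x. (F has_real_derivative h x) (at x)" "a \<le> b"
  shows "(h has_integral F b - F a) {a..b}"
  by (intro fundamental_theorem_of_calculus)
     (use assms in \<open>auto simp: has_real_derivative_iff_has_vector_derivative[symmetric]
        intro: has_field_derivative_at_within\<close>)

lemma has_integral_abs_bound:
  fixes f :: "real \<Rightarrow> real"
  assumes "(f has_integral i) {0..2 * pi}" "\<And>x. x \<in> {0..2 * pi} \<Longrightarrow> \<bar>f x\<bar> \<le> d"
  shows "\<bar>i\<bar> \<le> d * (2 * pi)"
proof -
  have "0 \<le> d" using assms(2)[of 0] by simp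
  from has_integral_bound_real[OF this _ assms(1), of "{}"] assms(2) show ?thesis by simp
qed

lemma antiderivative_exists:
  fixes h :: "real \<Rightarrow> real"
  assumes "continuous_on UNIV h"
  obtains H where "\<And>t. (H has_real_derivative h t) (at t)"
proof -
  have "\<exists>F. \<forall>t::real. -\<infinity> < ereal t \<longrightarrow> ereal t < \<infinity> \<longrightarrow> (F has_vector_derivative h t) (at t)"
    by (rule einterval_antiderivative) (use assms in \<open>auto simp: continuous_on_eq_continuous_at\<close>)
  then show ?thesis using that by (auto simp: has_real_derivative_iff_has_vector_derivative)
qed

lemma periodic_int_multiple:
  fixes f :: "real \<Rightarrow> 'a"
  assumes per: "\<And>x. f (x + c) = f x"
  shows "f (x + of_int k * c) = f x"
proof -
  have nat: "f (x + real n * c) = f x" for n x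
  proof (induction n)
    case (Suc n)
    then show ?case using per[of "x + real n * c"] by (simp add: algebra_simps)
  qed simp
  show ?thesis
  proof (cases "k \<ge> 0")
    case True then show ?thesis using nat[of x "nat k"] by simp
  next
    case False then show ?thesis using nat[of "x + of_int k * c" "nat (- k)"] by simp
  qed
qed

text \<open>
  With an antiderivative \<open>\<Lambda>\<close>, the function \<open>\<Lambda>(t + \<pi>) + \<Lambda>(t)\<close> is constant; comparing its values at
  \<open>0\<close> and \<open>\<pi>\<close> gives \<open>\<Lambda>(2\<pi>) = \<Lambda>(0)\<close>.
\<close>

lemma has_integral_antiperiodic:
  fixes H :: "real \<Rightarrow> real"
  assumes "continuous_on UNIV H" "\<And>x. H (x + pi) = - H x"
  shows "(H has_integral 0) {0..2 * pi}"
proof -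
  obtain \<Lambda> where \<Lambda>: "\<And>t. (\<Lambda> has_real_derivative H t) (at t)"
    using antiderivative_exists[OF assms(1)] by blast
  have "((\<lambda>t. \<Lambda> (t + pi) + \<Lambda> t) has_real_derivative 0) (at t)" for t
  proof -
    have "((\<lambda>t. \<Lambda> (t + pi)) has_real_derivative H (t + pi) * 1) (at t)"
      by (intro DERIV_chain2[OF \<Lambda>]) (auto intro!: derivative_eq_intros)
    from DERIV_add[OF this \<Lambda>[of t]] show ?thesis by (simp add: assms(2))
  qed
  then have "\<Lambda> (pi + pi) + \<Lambda> pi = \<Lambda> (0 + pi) + \<Lambda> 0"
    using DERIV_isconst_all[of "\<lambda>t. \<Lambda> (t + pi) + \<Lambda> t" pi 0] by blast
  with has_integral_derivative[OF \<Lambda>, of 0 "2 * pi"] show ?thesis by simp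
qed

lemma integral_half_period:
  fixes H :: "real \<Rightarrow> real"
  assumes "continuous_on UNIV H" "\<And>x. H (x + pi) = H x"
  shows "integral {0..pi} H = integral {0..2 * pi} H / 2"
proof -
  obtain \<Lambda> where \<Lambda>: "\<And>t. (\<Lambda> has_real_derivative H t) (at t)"
    using antiderivative_exists[OF assms(1)] by blast
  have "((\<lambda>t. \<Lambda> (t + pi) - \<Lambda> t) has_real_derivative 0) (at t)" for t
  proof -
    have "((\<lambda>t. \<Lambda> (t + pi)) has_real_derivative H (t + pi) * 1) (at t)"
      by (intro DERIV_chain2[OF \<Lambda>]) (auto intro!: derivative_eq_intros)
    from DERIV_diff[OF this \<Lambda>[of t]] show ?thesis by (simp add: assms(2))
  qed
  then have "\<Lambda> (pi + pi) - \<Lambda> pi = \<Lambda> (0 + pi) - \<Lambda> 0"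
    using DERIV_isconst_all[of "\<lambda>t. \<Lambda> (t + pi) - \<Lambda> t" pi 0] by blast
  moreover have "integral {0..pi} H = \<Lambda> pi - \<Lambda> 0" "integral {0..2 * pi} H = \<Lambda> (2 * pi) - \<Lambda> 0"
    by (intro integral_unique has_integral_derivative \<Lambda>; simp)+
  ultimately show ?thesis by simp
qed

section \<open>Density of trigonometric polynomials\<close>

text \<open>
  The frequencies form an arbitrary set rather than an initial segment, so that discarding
  frequencies only changes \<open>N\<close>.
\<close>

definition trig_sum :: "nat set \<Rightarrow> (nat \<Rightarrow> real) \<Rightarrow> (nat \<Rightarrow> real) \<Rightarrow> real \<Rightarrow> real" where
  "trig_sum N a b x = (\<Sum>n\<in>N. a n * cos (real n * x) + b n * sin (real n * x))"

definition trig_poly :: "(real \<Rightarrow> real) \<Rightarrow> bool" where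
  "trig_poly f \<longleftrightarrow> (\<exists>N a b. finite N \<and> f = trig_sum N a b)"

lemma trig_sum_extend:
  assumes "finite N'" "N \<subseteq> N'"
  shows "trig_sum N a b = trig_sum N' (\<lambda>n. if n \<in> N then a n else 0) (\<lambda>n. if n \<in> N then b n else 0)"
  unfolding trig_sum_def fun_eq_iff
  by (intro allI sum.mono_neutral_cong_left) (use assms in auto)

lemma trig_poly_add:
  assumes "trig_poly f" "trig_poly g"
  shows "trig_poly (\<lambda>x. f x + g x)"
proof -
  obtain N a b where 1: "finite N" "f = trig_sum N a b" using assms(1) unfolding trig_poly_def by blast
  obtain N' a' b' where 2: "finite N'" "g = trig_sum N' a' b'" using assms(2) unfolding trig_poly_def by blast
  define c where "c = (\<lambda>n. (if n \<in> N then a n else 0) + (if n \<in> N' then a' n else 0))"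
  define d where "d = (\<lambda>n. (if n \<in> N then b n else 0) + (if n \<in> N' then b' n else 0))"
  have "f = trig_sum (N \<union> N') (\<lambda>n. if n \<in> N then a n else 0) (\<lambda>n. if n \<in> N then b n else 0)"
    unfolding 1(2) by (rule trig_sum_extend) (use 1 2 in auto)
  moreover have "g = trig_sum (N \<union> N') (\<lambda>n. if n \<in> N' then a' n else 0) (\<lambda>n. if n \<in> N' then b' n else 0)"
    unfolding 2(2) by (rule trig_sum_extend) (use 1 2 in auto)
  ultimately have "(\<lambda>x. f x + g x) = trig_sum (N \<union> N') c d"
    by (simp add: trig_sum_def c_def d_def fun_eq_iff distrib_right flip: sum.distrib)
       (simp add: algebra_simps)
  then show ?thesis unfolding trig_poly_def using 1 2 by blast
qed

lemma trig_poly_scale: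
  assumes "trig_poly f"
  shows "trig_poly (\<lambda>x. c * f x)"
proof -
  obtain N a b where 1: "finite N" "f = trig_sum N a b" using assms(1) unfolding trig_poly_def by blast
  have "(\<lambda>x. c * f x) = trig_sum N (\<lambda>n. c * a n) (\<lambda>n. c * b n)"
    by (simp add: 1 trig_sum_def fun_eq_iff sum_distrib_left algebra_simps)
  then show ?thesis unfolding trig_poly_def using 1 by blast
qed

lemma trig_poly_cos: "trig_poly (\<lambda>x. cos (real n * x))"
proof -
  have "(\<lambda>x. cos (real n * x)) = trig_sum {n} (\<lambda>_. 1) (\<lambda>_. 0)" by (simp add: trig_sum_def fun_eq_iff)
  then show ?thesis unfolding trig_poly_def by blast
qed

lemma trig_poly_sin: "trig_poly (\<lambda>x. sin (real n * x))"
proof -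
  have "(\<lambda>x. sin (real n * x)) = trig_sum {n} (\<lambda>_. 0) (\<lambda>_. 1)" by (simp add: trig_sum_def fun_eq_iff)
  then show ?thesis unfolding trig_poly_def by blast
qed

lemma trig_poly_const: "trig_poly (\<lambda>x. c)"
  using trig_poly_scale[OF trig_poly_cos[of 0], of c] by simp

lemma trig_poly_sum:
  assumes "\<And>n. n \<in> N \<Longrightarrow> trig_poly (f n)"
  shows "trig_poly (\<lambda>x. \<Sum>n\<in>N. f n x)"
  using assms
  by (induction N rule: infinite_finite_induct) (auto intro: trig_poly_const trig_poly_add)

lemma trig_poly_cos_diff: "trig_poly (\<lambda>x. cos (real n * x - real k * x))"
proof (cases "k \<le> n")
  case True
  then have "(\<lambda>x. cos (real n * x - real k * x)) = (\<lambda>x. cos (real (n - k) * x))"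
    by (auto simp: of_nat_diff left_diff_distrib)
  then show ?thesis using trig_poly_cos by simp
next
  case False
  then have "(\<lambda>x. cos (real n * x - real k * x)) = (\<lambda>x. cos (- (real (k - n) * x)))"
    by (auto simp: of_nat_diff left_diff_distrib)
  then show ?thesis using trig_poly_cos by simp
qed

lemma trig_poly_sin_diff: "trig_poly (\<lambda>x. sin (real n * x - real k * x))"
proof (cases "k \<le> n")
  case True
  then have "(\<lambda>x. sin (real n * x - real k * x)) = (\<lambda>x. sin (real (n - k) * x))"
    by (auto simp: of_nat_diff left_diff_distrib)
  then show ?thesis using trig_poly_sin by simp
next
  case False
  then have "(\<lambda>x. sin (real n * x - real k * x)) = (\<lambda>x. sin (- (real (k - n) * x)))"
    by (auto simp: of_nat_diff left_diff_distrib)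
  then show ?thesis using trig_poly_scale[OF trig_poly_sin, of "-1"] by simp
qed

lemma trig_poly_basis_mult:
  "trig_poly (\<lambda>x. cos (real n * x) * cos (real k * x))"
  "trig_poly (\<lambda>x. cos (real n * x) * sin (real k * x))"
  "trig_poly (\<lambda>x. sin (real n * x) * cos (real k * x))"
  "trig_poly (\<lambda>x. sin (real n * x) * sin (real k * x))"
proof -
  have s: "real n * x + real k * x = real (n + k) * x" for x by (simp add: distrib_right)
  note i = trig_poly_add trig_poly_cos_diff trig_poly_sin_diff trig_poly_scale trig_poly_cos trig_poly_sin
  have "trig_poly (\<lambda>x. (1/2) * (cos (real n * x - real k * x) + cos (real (n + k) * x)))"
    by (intro i)
  then show "trig_poly (\<lambda>x. cos (real n * x) * cos (real k * x))" by (simp add: cos_times_cos s)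
  have "trig_poly (\<lambda>x. (1/2) * (sin (real (n + k) * x) + (-1) * sin (real n * x - real k * x)))"
    by (intro i)
  then show "trig_poly (\<lambda>x. cos (real n * x) * sin (real k * x))" by (simp add: cos_times_sin s)
  have "trig_poly (\<lambda>x. (1/2) * (sin (real (n + k) * x) + sin (real n * x - real k * x)))"
    by (intro i)
  then show "trig_poly (\<lambda>x. sin (real n * x) * cos (real k * x))" by (simp add: sin_times_cos s)
  have "trig_poly (\<lambda>x. (1/2) * (cos (real n * x - real k * x) + (-1) * cos (real (n + k) * x)))"
    by (intro i)
  then show "trig_poly (\<lambda>x. sin (real n * x) * sin (real k * x))" by (simp add: sin_times_sin s)
qed

lemma trig_poly_mult:
  assumes "trig_poly f" "trig_poly g"
  shows "trig_poly (\<lambda>x. f x * g x)"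
proof -
  obtain N a b where 1: "finite N" "f = trig_sum N a b" using assms(1) unfolding trig_poly_def by blast
  obtain N' a' b' where 2: "finite N'" "g = trig_sum N' a' b'" using assms(2) unfolding trig_poly_def by blast
  have eq: "(\<lambda>x. f x * g x) = (\<lambda>x. \<Sum>n\<in>N. \<Sum>k\<in>N'.
     (a n * a' k) * (cos (real n * x) * cos (real k * x)) +
     ((a n * b' k) * (cos (real n * x) * sin (real k * x)) +
     ((b n * a' k) * (sin (real n * x) * cos (real k * x)) +
     (b n * b' k) * (sin (real n * x) * sin (real k * x)))))"
    unfolding 1 2 trig_sum_def sum_product by (intro ext sum.cong refl) (simp add: algebra_simps)
  show ?thesis unfolding eq
    by (intro trig_poly_sum trig_poly_add trig_poly_scale trig_poly_basis_mult)
qed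

lemma trig_poly_polynomial_function:
  assumes "real_polynomial_function (h :: complex \<Rightarrow> real)"
  shows "trig_poly (\<lambda>x. h (cis x))"
  using assms
proof (induction h rule: real_polynomial_function.induct)
  case (linear h)
  then interpret bounded_linear h .
  have "h (cis x) = h 1 * cos (real 1 * x) + h \<i> * sin (real 1 * x)" for x
  proof -
    have "cis x = cos x *\<^sub>R 1 + sin x *\<^sub>R \<i>" by (simp add: complex_eq_iff)
    then have "h (cis x) = cos x *\<^sub>R h 1 + sin x *\<^sub>R h \<i>" by (simp only: add scaleR)
    then show ?thesis by simp
  qed
  moreover have "trig_poly (\<lambda>x. h 1 * cos (real 1 * x) + h \<i> * sin (real 1 * x))"
    by (intro trig_poly_add trig_poly_scale trig_poly_cos trig_poly_sin)
  ultimately show ?case by simp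
qed (auto intro: trig_poly_const trig_poly_add trig_poly_mult)

text \<open>
  The candidate is \<open>f \<circ> Arg\<close>. It is continuous off the negative axis, where the principal argument
  jumps; there it agrees with \<open>f \<circ> Arg2pi\<close>, whose jump lies on the positive axis.
\<close>

lemma periodic_function_on_circle:
  fixes f :: "real \<Rightarrow> real"
  assumes cont: "continuous_on UNIV f" and per: "\<And>x. f (x + 2 * pi) = f x"
  obtains F :: "complex \<Rightarrow> real" where "continuous_on (sphere 0 1) F" "\<And>x. F (cis x) = f x"
proof
  define F where "F = (\<lambda>z. f (Arg z))"
  have cis_eq: "f x = f y" if "cis x = cis y" for x y
  proof -
    have "sin x = sin y" "cos x = cos y" using that by (simp_all add: complex_eq_iff)
    then obtain k :: int where "x = y + 2 * pi * k" using sin_cos_eq_iff by blast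
    then show ?thesis using periodic_int_multiple[of f "2 * pi" y k, OF per] by (simp add: mult.commute)
  qed
  show "F (cis x) = f x" for x
    unfolding F_def by (rule cis_eq) (simp add: cis_Arg sgn_div_norm)
  have F2: "F z = f (Arg2pi z)" if "z \<noteq> 0" for z
  proof -
    have "cis (Arg z) = cis (Arg2pi z)"
    proof -
      have "complex_of_real (cmod z) * cis (Arg z) = complex_of_real (cmod z) * cis (Arg2pi z)"
        using Arg2pi_eq[of z] rcis_cmod_Arg[of z] by (simp add: rcis_def cis_conv_exp)
      then show ?thesis using that by simp
    qed
    then show ?thesis unfolding F_def by (rule cis_eq)
  qed
  have isc: "isCont f x" for x using cont by (simp add: continuous_on_eq_continuous_at)
  have "isCont F z" if "z \<noteq> 0" for z
  proof (cases "z \<in> \<real>\<^sub>\<le>\<^sub>0")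
    case False
    then show ?thesis unfolding F_def
      by (intro isCont_o2[OF continuous_at_Arg isc])
  next
    case True
    then have "z \<notin> \<real>\<^sub>\<ge>\<^sub>0" using that by (auto elim!: nonpos_Reals_cases nonneg_Reals_cases)
    then have c: "isCont (\<lambda>z. f (Arg2pi z)) z"
      by (intro isCont_o2[OF continuous_at_Arg2pi isc])
    have "\<forall>\<^sub>F w in nhds z. F w = f (Arg2pi w)"
      using t1_space_nhds[OF that] by eventually_elim (rule F2)
    then show ?thesis using isCont_cong[of F "\<lambda>z. f (Arg2pi z)" z] c by simp
  qed
  then show "continuous_on (sphere 0 1) F"
    by (intro continuous_at_imp_continuous_on) (metis norm_zero mem_sphere_0 zero_neq_one)
qed

text \<open>
  Stone-Weierstrass on the unit circle: a polynomial in the coordinates \<open>(cos x, sin x)\<close> is a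
  trigonometric polynomial by the product-to-sum formulas.
\<close>

lemma trig_poly_dense:
  fixes f :: "real \<Rightarrow> real"
  assumes "continuous_on UNIV f" "\<And>x. f (x + 2 * pi) = f x" "e > 0"
  obtains q where "trig_poly q" "\<And>x. \<bar>f x - q x\<bar> < e"
proof -
  obtain F :: "complex \<Rightarrow> real" where F: "continuous_on (sphere 0 1) F" "\<And>x. F (cis x) = f x"
    using periodic_function_on_circle[OF assms(1,2)] by metis
  obtain h where h: "real_polynomial_function h" "\<And>z. z \<in> sphere 0 1 \<Longrightarrow> \<bar>F z - h z\<bar> < e"
    using Stone_Weierstrass_real_polynomial_function[OF compact_sphere F(1) assms(3)] by metis
  show ?thesis
  proof (rule that[of "\<lambda>x. h (cis x)"])
    show "trig_poly (\<lambda>x. h (cis x))" by (rule trig_poly_polynomial_function[OF h(1)])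
    show "\<bar>f x - h (cis x)\<bar> < e" for x using h(2)[of "cis x"] F(2)[of x] by simp
  qed
qed

section \<open>Orthogonality and finite Wirtinger inequalities\<close>

lemma has_integral_cos_multiple:
  "((\<lambda>x. cos (c * x)) has_integral (sin (c * t) / c)) {0..t}" if "c \<noteq> 0" "t \<ge> 0" for c :: real
proof -
  have "((\<lambda>x. sin (c * x) / c) has_vector_derivative cos (c * x)) (at x within {0..t})" for x
    unfolding has_real_derivative_iff_has_vector_derivative[symmetric] using that(1)
    by (auto intro!: derivative_eq_intros)
  from fundamental_theorem_of_calculus[OF that(2) this] show ?thesis by simp
qed

lemma has_integral_sin_multiple:
  "((\<lambda>x. sin (c * x)) has_integral ((1 - cos (c * t)) / c)) {0..t}" if "c \<noteq> 0" "t \<ge> 0" for c :: real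
proof -
  have "((\<lambda>x. - cos (c * x) / c) has_vector_derivative sin (c * x)) (at x within {0..t})" for x
    unfolding has_real_derivative_iff_has_vector_derivative[symmetric] using that(1)
    by (auto intro!: derivative_eq_intros)
  from fundamental_theorem_of_calculus[OF that(2) this] show ?thesis
    by (simp add: diff_divide_distrib)
qed

lemma has_integral_cos_period:
  "((\<lambda>x. cos (of_int j * x)) has_integral (if j = 0 then 2 * pi else 0)) {0..2 * pi}"
proof (cases "j = 0")
  case True
  then show ?thesis using has_integral_const_real[of "1::real" 0 "2 * pi"] by simp
next
  case False
  have "((\<lambda>x. cos (of_int j * x)) has_integral (sin (of_int j * (2 * pi)) / of_int j)) {0..2 * pi}"
    by (rule has_integral_cos_multiple) (use False in auto)
  moreover have "sin (of_int j * (2 * pi)) = 0"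
    using sin_int_2pin[of j] by (simp add: mult_ac)
  ultimately show ?thesis using False by simp
qed

lemma has_integral_sin_period:
  "((\<lambda>x. sin (of_int j * x)) has_integral 0) {0..2 * pi}"
proof (cases "j = 0")
  case True
  then show ?thesis by simp
next
  case False
  have "((\<lambda>x. sin (of_int j * x)) has_integral ((1 - cos (of_int j * (2 * pi))) / of_int j)) {0..2 * pi}"
    by (rule has_integral_sin_multiple) (use False in auto)
  moreover have "cos (of_int j * (2 * pi)) = 1"
    using cos_int_2pin[of j] by (simp add: mult_ac)
  ultimately show ?thesis using False by simp
qed

lemma has_integral_trig_products:
  fixes n k :: nat
  shows "((\<lambda>x. cos (real n * x) * cos (real k * x)) has_integral
            (if n = k then if k = 0 then 2 * pi else pi else 0)) {0..2 * pi}"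
    and "((\<lambda>x. sin (real n * x) * sin (real k * x)) has_integral
            (if n = k \<and> k \<noteq> 0 then pi else 0)) {0..2 * pi}"
    and "((\<lambda>x. cos (real n * x) * sin (real k * x)) has_integral 0) {0..2 * pi}"
    and "((\<lambda>x. sin (real n * x) * cos (real k * x)) has_integral 0) {0..2 * pi}"
proof -
  have d: "real n * x - real k * x = of_int (int n - int k) * x"
    and s: "real n * x + real k * x = of_int (int n + int k) * x" for x
    by (simp_all add: algebra_simps)
  note c = has_integral_cos_period and si = has_integral_sin_period
  show "((\<lambda>x. cos (real n * x) * cos (real k * x)) has_integral
            (if n = k then if k = 0 then 2 * pi else pi else 0)) {0..2 * pi}"
    unfolding cos_times_cos d s
    by (rule has_integral_eq_rhs[OF has_integral_divide[OF has_integral_add[OF c c]]]) auto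
  show "((\<lambda>x. sin (real n * x) * sin (real k * x)) has_integral
            (if n = k \<and> k \<noteq> 0 then pi else 0)) {0..2 * pi}"
    unfolding sin_times_sin d s
    by (rule has_integral_eq_rhs[OF has_integral_divide[OF has_integral_diff[OF c c]]]) auto
  show "((\<lambda>x. cos (real n * x) * sin (real k * x)) has_integral 0) {0..2 * pi}"
    unfolding cos_times_sin d s
    by (rule has_integral_eq_rhs[OF has_integral_divide[OF has_integral_diff[OF si si]]]) auto
  show "((\<lambda>x. sin (real n * x) * cos (real k * x)) has_integral 0) {0..2 * pi}"
    unfolding sin_times_cos d s
    by (rule has_integral_eq_rhs[OF has_integral_divide[OF has_integral_add[OF si si]]]) auto
qed

lemma has_integral_trig_sum_cos:
  assumes "finite N"
  shows "((\<lambda>x. trig_sum N a b x * cos (real k * x)) has_integral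
           (if k \<in> N then (if k = 0 then 2 * pi else pi) * a k else 0)) {0..2 * pi}"
proof -
  have "((\<lambda>x. \<Sum>n\<in>N. a n * (cos (real n * x) * cos (real k * x)) + b n * (sin (real n * x) * cos (real k * x)))
     has_integral (\<Sum>n\<in>N. a n * (if n = k then if k = 0 then 2 * pi else pi else 0) + b n * 0)) {0..2 * pi}"
    by (intro has_integral_sum assms has_integral_add has_integral_mult_right has_integral_trig_products)
  moreover have "(\<Sum>n\<in>N. a n * (if n = k then if k = 0 then 2 * pi else pi else 0) + b n * 0)
      = (\<Sum>n\<in>N. if k = n then (if k = 0 then 2 * pi else pi) * a k else 0)"
    by (intro sum.cong) auto
  moreover have "trig_sum N a b x * cos (real k * x) =
     (\<Sum>n\<in>N. a n * (cos (real n * x) * cos (real k * x)) + b n * (sin (real n * x) * cos (real k * x)))" for x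
    unfolding trig_sum_def sum_distrib_right by (intro sum.cong refl) (simp add: distrib_right mult.assoc)
  ultimately show ?thesis using assms(1) by (simp add: sum.delta)
qed

lemma has_integral_trig_sum_sin:
  assumes "finite N" "k \<noteq> 0"
  shows "((\<lambda>x. trig_sum N a b x * sin (real k * x)) has_integral
           (if k \<in> N then pi * b k else 0)) {0..2 * pi}"
proof -
  have "((\<lambda>x. \<Sum>n\<in>N. a n * (cos (real n * x) * sin (real k * x)) + b n * (sin (real n * x) * sin (real k * x)))
     has_integral (\<Sum>n\<in>N. a n * 0 + b n * (if n = k \<and> k \<noteq> 0 then pi else 0))) {0..2 * pi}"
    by (intro has_integral_sum assms has_integral_add has_integral_mult_right has_integral_trig_products)
  moreover have "(\<Sum>n\<in>N. a n * 0 + b n * (if n = k \<and> k \<noteq> 0 then pi else 0))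
      = (\<Sum>n\<in>N. if k = n then pi * b k else 0)"
    using assms by (intro sum.cong) auto
  moreover have "trig_sum N a b x * sin (real k * x) =
     (\<Sum>n\<in>N. a n * (cos (real n * x) * sin (real k * x)) + b n * (sin (real n * x) * sin (real k * x)))" for x
    unfolding trig_sum_def sum_distrib_right by (intro sum.cong refl) (simp add: distrib_right mult.assoc)
  ultimately show ?thesis using assms(1) by (simp add: sum.delta)
qed

lemma has_integral_trig_sum_square:
  assumes "finite N" "0 \<notin> N"
  shows "((\<lambda>x. (trig_sum N a b x)\<^sup>2) has_integral pi * (\<Sum>n\<in>N. (a n)\<^sup>2 + (b n)\<^sup>2)) {0..2 * pi}"
proof -
  have "((\<lambda>x. \<Sum>n\<in>N. a n * (trig_sum N a b x * cos (real n * x)) + b n * (trig_sum N a b x * sin (real n * x)))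
     has_integral (\<Sum>n\<in>N. a n * (if n \<in> N then (if n = 0 then 2 * pi else pi) * a n else 0)
                        + b n * (if n \<in> N then pi * b n else 0))) {0..2 * pi}"
    by (intro has_integral_sum assms has_integral_add has_integral_mult_right
              has_integral_trig_sum_cos has_integral_trig_sum_sin) (use assms in metis)
  moreover have "(\<Sum>n\<in>N. a n * (if n \<in> N then (if n = 0 then 2 * pi else pi) * a n else 0)
                        + b n * (if n \<in> N then pi * b n else 0)) = pi * (\<Sum>n\<in>N. (a n)\<^sup>2 + (b n)\<^sup>2)"
    unfolding sum_distrib_left using assms
    by (intro sum.cong) (auto simp: power2_eq_square algebra_simps)
  moreover have "(\<Sum>n\<in>N. a n * (trig_sum N a b x * cos (real n * x)) + b n * (trig_sum N a b x * sin (real n * x)))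
       = (trig_sum N a b x)\<^sup>2" for x
  proof -
    have "(\<Sum>n\<in>N. a n * (y * cos (real n * x)) + b n * (y * sin (real n * x))) = y * trig_sum N a b x" for y
      unfolding trig_sum_def sum_distrib_left by (intro sum.cong refl) (simp only: distrib_left mult.left_commute)
    then show ?thesis by (simp add: power2_eq_square)
  qed
  ultimately show ?thesis by simp
qed

text \<open>
  Along one parity class, \<open>1 / (n\<^sup>2 - 1) = (1 / (n - 1) - 1 / (n + 1)) / 2\<close> telescopes in steps
  of \<open>2\<close>.
\<close>

lemma sum_inverse_bound:
  assumes "finite N" "2 \<le> c" "\<And>n. n \<in> N \<Longrightarrow> c \<le> n \<and> (even n \<longleftrightarrow> even c)"
  shows "(\<Sum>n\<in>N. 1 / ((real n)\<^sup>2 - 1)) \<le> 1 / (2 * (real c - 1))"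
proof -
  have term_eq: "1 / ((real (c + 2 * k))\<^sup>2 - 1) =
      1 / (2 * (real c + 2 * real k - 1)) - 1 / (2 * (real c + 2 * real (Suc k) - 1))" for k
  proof -
    have *: "1 / (y\<^sup>2 - 1) = 1 / (2 * (y - 1)) - 1 / (2 * (y + 1))" if "1 < y" for y :: real
    proof -
      have sq: "y\<^sup>2 - 1 = (y - 1) * (y + 1)" by (simp add: power2_eq_square algebra_simps)
      have "y - 1 \<noteq> 0" "y + 1 \<noteq> 0" using that by auto
      then show ?thesis unfolding sq by (simp add: divide_simps) (simp add: algebra_simps)
    qed
    show ?thesis using *[of "real c + 2 * real k"] assms(2) by (simp add: algebra_simps)
  qed
  have tele: "(\<Sum>k<m. 1 / ((real (c + 2 * k))\<^sup>2 - 1)) =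
      1 / (2 * (real c - 1)) - 1 / (2 * (real c + 2 * real m - 1))" for m
    by (induction m) (simp_all only: sum.lessThan_Suc term_eq, simp_all)
  obtain m where m: "\<And>n. n \<in> N \<Longrightarrow> n < m" using assms(1) by (metis finite_nat_set_iff_bounded)
  have sub: "N \<subseteq> (\<lambda>k. c + 2 * k) ` {..<m}"
  proof
    fix n assume n: "n \<in> N"
    from assms(3)[OF n] have "even (n - c)" "c \<le> n" by auto
    then obtain k where "n - c = 2 * k" by (elim evenE)
    with \<open>c \<le> n\<close> m[OF n] have "n = c + 2 * k" "k < m" by auto
    then show "n \<in> (\<lambda>k. c + 2 * k) ` {..<m}" by blast
  qed
  have "(\<Sum>n\<in>N. 1 / ((real n)\<^sup>2 - 1)) \<le> (\<Sum>n\<in>(\<lambda>k. c + 2 * k) ` {..<m}. 1 / ((real n)\<^sup>2 - 1))"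
  proof (rule sum_mono2[OF _ sub])
    fix n assume "n \<in> (\<lambda>k. c + 2 * k) ` {..<m} - N"
    then have "1 \<le> real n" using assms(2) by auto
    then have "1 \<le> (real n)\<^sup>2" by (simp add: one_le_power)
    then show "0 \<le> 1 / ((real n)\<^sup>2 - 1)" by simp
  qed simp
  also have "\<dots> = (\<Sum>k<m. 1 / ((real (c + 2 * k))\<^sup>2 - 1))"
    by (subst sum.reindex) (auto simp: inj_on_def)
  also have "\<dots> \<le> 1 / (2 * (real c - 1))"
    unfolding tele using assms(2) by simp
  finally show ?thesis .
qed

text \<open>
  Both estimates follow from \<open>\<integral> T'\<^sup>2 - \<integral> T\<^sup>2 = \<pi> \<Sum> (n\<^sup>2 - 1) \<rho>\<^sub>n\<^sup>2\<close>, where \<open>\<rho>\<^sub>n\<close> is the amplitude of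
  the \<open>n\<close>-th harmonic. For the pointwise one, \<open>\<bar>T x\<bar> \<le> \<Sum> \<rho>\<^sub>n\<close>, and the Cauchy-Schwarz inequality
  is applied to \<open>\<rho>\<^sub>n = (n\<^sup>2 - 1)\<^bsup>-1/2\<^esup> ((n\<^sup>2 - 1)\<^bsup>1/2\<^esup> \<rho>\<^sub>n)\<close>.
\<close>

lemma trig_sum_inequalities:
  fixes a b :: "nat \<Rightarrow> real"
  assumes N: "finite N" "2 \<le> c" "\<And>n. n \<in> N \<Longrightarrow> c \<le> n \<and> (even n \<longleftrightarrow> even c)"
  defines "T \<equiv> trig_sum N a b"
    and "T' \<equiv> trig_sum N (\<lambda>n. real n * b n) (\<lambda>n. - real n * a n)"
  shows "2 * pi * (real c - 1) * (T x)\<^sup>2 \<le> integral {0..2 * pi} (\<lambda>t. (T' t)\<^sup>2) - integral {0..2 * pi} (\<lambda>t. (T t)\<^sup>2)"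
    and "((real c)\<^sup>2 - 1) * integral {0..2 * pi} (\<lambda>t. (T t)\<^sup>2)
       \<le> integral {0..2 * pi} (\<lambda>t. (T' t)\<^sup>2) - integral {0..2 * pi} (\<lambda>t. (T t)\<^sup>2)"
proof -
  define s where "s = (\<lambda>n. (a n)\<^sup>2 + (b n)\<^sup>2)"
  define w where "w = (\<lambda>n. (real n)\<^sup>2 - 1)"
  have s0: "0 \<le> s n" for n by (simp add: s_def)
  have N0: "0 \<notin> N" using N by force
  have wc: "(real c)\<^sup>2 - 1 \<le> w n" if "n \<in> N" for n
    using N(3)[OF that] by (simp add: w_def power_mono)
  have "1 < (real c)\<^sup>2" using N(2) by (simp add: one_less_power)
  then have w0: "0 < w n" if "n \<in> N" for n using wc[OF that] by linarith
  have I: "integral {0..2 * pi} (\<lambda>t. (T t)\<^sup>2) = pi * (\<Sum>n\<in>N. s n)"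
    unfolding T_def s_def by (rule integral_unique has_integral_trig_sum_square N N0)+
  have "integral {0..2 * pi} (\<lambda>t. (T' t)\<^sup>2) = pi * (\<Sum>n\<in>N. (real n * b n)\<^sup>2 + (- real n * a n)\<^sup>2)"
    unfolding T'_def by (rule integral_unique has_integral_trig_sum_square N N0)+
  also have "\<dots> = pi * (\<Sum>n\<in>N. (w n + 1) * s n)"
    by (simp add: w_def s_def power_mult_distrib distrib_left add.commute)
  finally have Q: "integral {0..2 * pi} (\<lambda>t. (T' t)\<^sup>2) - integral {0..2 * pi} (\<lambda>t. (T t)\<^sup>2) = pi * (\<Sum>n\<in>N. w n * s n)"
    unfolding I by (simp add: distrib_right sum.distrib right_diff_distrib distrib_left)
  show "((real c)\<^sup>2 - 1) * integral {0..2 * pi} (\<lambda>t. (T t)\<^sup>2)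
       \<le> integral {0..2 * pi} (\<lambda>t. (T' t)\<^sup>2) - integral {0..2 * pi} (\<lambda>t. (T t)\<^sup>2)"
  proof -
    have "((real c)\<^sup>2 - 1) * (\<Sum>n\<in>N. s n) \<le> (\<Sum>n\<in>N. w n * s n)"
      unfolding sum_distrib_left by (intro sum_mono mult_right_mono wc s0)
    then have "pi * (((real c)\<^sup>2 - 1) * (\<Sum>n\<in>N. s n)) \<le> pi * (\<Sum>n\<in>N. w n * s n)" by simp
    then show ?thesis unfolding Q unfolding I by (simp only: mult_ac)
  qed
  have rot: "\<bar>a n * cos (real n * x) + b n * sin (real n * x)\<bar> \<le> sqrt (s n)" for n
  proof (rule real_le_rsqrt)
    let ?C = "cos (real n * x)" and ?S = "sin (real n * x)"
    have "s n = s n * (?S\<^sup>2 + ?C\<^sup>2)" by simp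
    also have "\<dots> = (a n * ?C + b n * ?S)\<^sup>2 + (a n * ?S - b n * ?C)\<^sup>2"
      unfolding s_def by (simp only: power2_eq_square) algebra
    finally show "\<bar>a n * ?C + b n * ?S\<bar>\<^sup>2 \<le> s n" by simp
  qed
  have "\<bar>T x\<bar> \<le> (\<Sum>n\<in>N. sqrt (s n))"
    unfolding T_def trig_sum_def by (rule order_trans[OF sum_abs sum_mono[OF rot]])
  also have "\<dots> = (\<Sum>n\<in>N. sqrt (1 / w n) * sqrt (w n * s n))"
    by (intro sum.cong refl) (use w0 in \<open>force simp flip: real_sqrt_mult\<close>)
  finally have "(T x)\<^sup>2 \<le> (\<Sum>n\<in>N. sqrt (1 / w n) * sqrt (w n * s n))\<^sup>2"
    by (metis abs_ge_zero power2_abs power_mono)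
  also have "\<dots> \<le> (\<Sum>n\<in>N. (sqrt (1 / w n))\<^sup>2) * (\<Sum>n\<in>N. (sqrt (w n * s n))\<^sup>2)"
    by (rule Cauchy_Schwarz_ineq_sum)
  also have "\<dots> = (\<Sum>n\<in>N. 1 / w n) * (\<Sum>n\<in>N. w n * s n)"
    using w0 s0 by (intro arg_cong2[of _ _ _ _ "(*)"] sum.cong refl) (auto simp: less_imp_le)
  also have "\<dots> \<le> 1 / (2 * (real c - 1)) * (\<Sum>n\<in>N. w n * s n)"
    using sum_inverse_bound[OF N] w0 s0
    by (intro mult_right_mono sum_nonneg) (auto simp: w_def less_imp_le)
  finally have "2 * (real c - 1) * (T x)\<^sup>2 \<le> (\<Sum>n\<in>N. w n * s n)"
    using N(2) by (simp add: field_simps)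
  then have "pi * (2 * (real c - 1) * (T x)\<^sup>2) \<le> pi * (\<Sum>n\<in>N. w n * s n)" by simp
  then show "2 * pi * (real c - 1) * (T x)\<^sup>2 \<le> integral {0..2 * pi} (\<lambda>t. (T' t)\<^sup>2) - integral {0..2 * pi} (\<lambda>t. (T t)\<^sup>2)"
    unfolding Q by (simp only: mult_ac)
qed

section \<open>Uniform approximation with prescribed frequencies\<close>

text \<open>
  A function without \<open>k\<close>-th harmonic can be close to a trigonometric polynomial only if the \<open>k\<close>-th
  coefficients of the latter are small. Hence finitely many forbidden frequencies can be deleted
  from an approximation without spoiling it.
\<close>

lemma trig_sum_cos_coeff_bound:
  assumes "finite N" "k \<in> N"
    and "\<And>x. \<bar>h x - trig_sum N a b x\<bar> \<le> d"
    and "((\<lambda>x. h x * cos (real k * x)) has_integral 0) {0..2 * pi}"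
  shows "\<bar>a k\<bar> \<le> 2 * d"
proof -
  let ?w = "(if k = 0 then 2 * pi else pi) * a k"
  have d: "0 \<le> d" using assms(3)[of 0] by linarith
  have "((\<lambda>x. h x * cos (real k * x) - trig_sum N a b x * cos (real k * x)) has_integral 0 - ?w) {0..2 * pi}"
    using has_integral_diff[OF assms(4) has_integral_trig_sum_cos[OF assms(1), of a b k]] assms(2) by simp
  then have "\<bar>0 - ?w\<bar> \<le> d * (2 * pi)"
  proof (rule has_integral_abs_bound)
    fix x
    have "\<bar>(h x - trig_sum N a b x) * cos (real k * x)\<bar> \<le> d * 1"
      unfolding abs_mult by (intro mult_mono assms(3) d) auto
    then show "\<bar>h x * cos (real k * x) - trig_sum N a b x * cos (real k * x)\<bar> \<le> d"
      by (simp add: left_diff_distrib)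
  qed
  then have "\<bar>?w\<bar> \<le> d * (2 * pi)" by simp
  moreover have "pi * \<bar>a k\<bar> \<le> \<bar>?w\<bar>" by (simp add: abs_mult)
  moreover have "d * (2 * pi) = pi * (2 * d)" by simp
  ultimately have "pi * \<bar>a k\<bar> \<le> pi * (2 * d)" by linarith
  then show ?thesis by simp
qed

lemma trig_sum_sin_coeff_bound:
  assumes "finite N" "k \<in> N" "k \<noteq> 0"
    and "\<And>x. \<bar>h x - trig_sum N a b x\<bar> \<le> d"
    and "((\<lambda>x. h x * sin (real k * x)) has_integral 0) {0..2 * pi}"
  shows "\<bar>b k\<bar> \<le> 2 * d"
proof -
  have d: "0 \<le> d" using assms(4)[of 0] by linarith
  have "((\<lambda>x. h x * sin (real k * x) - trig_sum N a b x * sin (real k * x)) has_integral 0 - pi * b k) {0..2 * pi}"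
    using has_integral_diff[OF assms(5) has_integral_trig_sum_sin[OF assms(1,3), of a b]] assms(2) by simp
  then have "\<bar>0 - pi * b k\<bar> \<le> d * (2 * pi)"
  proof (rule has_integral_abs_bound)
    fix x
    have "\<bar>(h x - trig_sum N a b x) * sin (real k * x)\<bar> \<le> d * 1"
      unfolding abs_mult by (intro mult_mono assms(4) d) auto
    then show "\<bar>h x * sin (real k * x) - trig_sum N a b x * sin (real k * x)\<bar> \<le> d"
      by (simp add: left_diff_distrib)
  qed
  then have "pi * \<bar>b k\<bar> \<le> pi * (2 * d)" by (simp add: abs_mult mult_ac)
  then show ?thesis by simp
qed

text \<open>
  The shift by \<open>\<pi>\<close> multiplies the \<open>n\<close>-th harmonic by \<open>(-1)\<^sup>n\<close>, so averaging over it selects a parity.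
\<close>

lemma trig_sum_shift_pi:
  assumes "finite N" "\<sigma> = 1 \<or> \<sigma> = -1"
  shows "(trig_sum N a b x + \<sigma> * trig_sum N a b (x + pi)) / 2 = trig_sum {n \<in> N. (-1) ^ n = \<sigma>} a b x"
proof -
  have c: "cos (real n * (x + pi)) = (-1) ^ n * cos (real n * x)"
    and s: "sin (real n * (x + pi)) = (-1) ^ n * sin (real n * x)" for n
    by (simp_all add: distrib_left cos_add sin_add)
  have "(trig_sum N a b x + \<sigma> * trig_sum N a b (x + pi)) / 2 =
     (\<Sum>n\<in>N. (1 + \<sigma> * (-1) ^ n) / 2 * (a n * cos (real n * x) + b n * sin (real n * x)))"
    unfolding trig_sum_def c s sum_distrib_left sum.distrib[symmetric] sum_divide_distrib
    by (intro sum.cong refl) (simp add: field_simps)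
  also have "\<dots> = (\<Sum>n\<in>N. if (-1) ^ n = \<sigma> then a n * cos (real n * x) + b n * sin (real n * x) else 0)"
  proof (intro sum.cong refl)
    fix n
    show "(1 + \<sigma> * (-1) ^ n) / 2 * (a n * cos (real n * x) + b n * sin (real n * x))
       = (if (-1) ^ n = \<sigma> then a n * cos (real n * x) + b n * sin (real n * x) else 0)"
      using assms(2) by (cases "even n") auto
  qed
  also have "\<dots> = trig_sum {n \<in> N. (-1) ^ n = \<sigma>} a b x"
    unfolding trig_sum_def using assms(1) by (simp add: sum.If_cases Int_def)
  finally show ?thesis .
qed

text \<open>
  An arbitrary approximation is first averaged over the shift by \<open>\<pi>\<close>, which restores the symmetry
  of \<open>h\<close> at no loss, and then deprived of its frequencies \<open>0\<close> and \<open>1\<close>, which costs a constant factor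
  by the coefficient bounds.
\<close>

lemma symmetric_trig_approx:
  fixes h :: "real \<Rightarrow> real"
  assumes cont: "continuous_on UNIV h"
    and \<sigma>: "\<sigma> = 1 \<or> \<sigma> = -1"
    and sym: "\<And>x. h (x + pi) = \<sigma> * h x"
    and orth: "(h has_integral 0) {0..2 * pi}"
      "((\<lambda>x. h x * cos x) has_integral 0) {0..2 * pi}"
      "((\<lambda>x. h x * sin x) has_integral 0) {0..2 * pi}"
    and e: "e > 0"
  obtains N a b where "finite N" "\<And>n. n \<in> N \<Longrightarrow> 2 \<le> n \<and> (-1) ^ n = \<sigma>"
    "\<And>x. \<bar>h x - trig_sum N a b x\<bar> \<le> e"
proof -
  have per: "h (x + 2 * pi) = h x" for x
    using sym[of x] sym[of "x + pi"] \<sigma> by (auto simp: add.assoc)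
  \<comment> \<open>The error is \<open>d\<close> for the averaged approximation, \<open>2d\<close> for deleting the constant term and \<open>4d\<close>
     for deleting the two terms of frequency \<open>1\<close>.\<close>
  define d where "d = e / 7"
  have d: "d > 0" using e by (simp add: d_def)
  obtain q where q: "trig_poly q" "\<And>x. \<bar>h x - q x\<bar> < d"
    using trig_poly_dense[OF cont per d] by metis
  obtain M a b where M: "finite M" "q = trig_sum M a b" using q(1) unfolding trig_poly_def by blast
  define M' where "M' = {n \<in> M. (-1) ^ n = \<sigma>}"
  have fM': "finite M'" using M by (simp add: M'_def)
  have close: "\<bar>h x - trig_sum M' a b x\<bar> \<le> d" for x
  proof -
    have "h x - trig_sum M' a b x = (h x - q x) / 2 + \<sigma> * (h (x + pi) - q (x + pi)) / 2"
      unfolding M'_def trig_sum_shift_pi[OF M(1) \<sigma>, symmetric] M(2)[symmetric] using sym[of x] \<sigma>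
      by (auto simp: field_simps)
    moreover have "\<bar>\<sigma> * (h (x + pi) - q (x + pi)) / 2\<bar> \<le> d / 2"
      using q(2)[of "x + pi"] \<sigma> by (auto simp: abs_mult)
    moreover have "\<bar>(h x - q x) / 2\<bar> \<le> d / 2" using q(2)[of x] by simp
    ultimately show ?thesis by linarith
  qed
  define t where "t = (\<lambda>n x. a n * cos (real n * x) + b n * sin (real n * x))"
  have t0: "\<bar>t 0 x\<bar> \<le> 2 * d" if "0 \<in> M'" for x
    using trig_sum_cos_coeff_bound[OF fM' that close] orth(1) by (simp add: t_def)
  have t1: "\<bar>t 1 x\<bar> \<le> 4 * d" if "1 \<in> M'" for x
  proof -
    have "\<bar>a 1\<bar> \<le> 2 * d" using trig_sum_cos_coeff_bound[OF fM' that close] orth(2) by simp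
    moreover have "\<bar>b 1\<bar> \<le> 2 * d" using trig_sum_sin_coeff_bound[OF fM' that _ close] orth(3) by simp
    moreover have "\<bar>a 1 * cos x\<bar> \<le> \<bar>a 1\<bar> * 1" "\<bar>b 1 * sin x\<bar> \<le> \<bar>b 1\<bar> * 1"
      unfolding abs_mult by (intro mult_mono; simp)+
    ultimately show ?thesis by (simp add: t_def)
  qed
  define N where "N = M' - {0, 1}"
  have split: "trig_sum M' a b x = trig_sum N a b x + (\<Sum>n\<in>M' \<inter> {0, 1}. t n x)" for x
    unfolding trig_sum_def N_def t_def
    using fM' by (subst add.commute, subst sum.Int_Diff[of M' _ "{0, 1}"]) auto
  have small: "\<bar>\<Sum>n\<in>M' \<inter> {0, 1}. t n x\<bar> \<le> 6 * d" for x
  proof -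
    have "(\<Sum>n\<in>M' \<inter> {0, 1}. t n x) = (\<Sum>n\<in>{0, 1}. if n \<in> M' then t n x else 0)"
      by (simp add: sum.inter_restrict Int_commute)
    also have "\<dots> = (if 0 \<in> M' then t 0 x else 0) + (if 1 \<in> M' then t 1 x else 0)" by simp
    finally show ?thesis using t0[of x] t1[of x] d by auto
  qed
  show ?thesis
  proof (rule that[of N a b])
    show "finite N" using fM' by (simp add: N_def)
    show "2 \<le> n \<and> (-1) ^ n = \<sigma>" if "n \<in> N" for n
      using that by (auto simp: N_def M'_def)
    show "\<bar>h x - trig_sum N a b x\<bar> \<le> e" for x
      using close[of x] small[of x] split[of x] unfolding d_def by linarith
  qed
qed

lemma trig_sum_has_derivative:
  "(trig_sum N a b has_real_derivative
     trig_sum N (\<lambda>n. real n * b n) (\<lambda>n. - real n * a n) x) (at x within S)"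
  unfolding trig_sum_def[abs_def]
  by (rule derivative_eq_intros DERIV_sum refl | simp add: algebra_simps)+

text \<open>
  Passes from an approximation of derivatives to one of the functions: a function of mean zero is
  bounded by its oscillation.
\<close>

lemma mean_zero_bound:
  fixes D D' :: "real \<Rightarrow> real"
  assumes deriv: "\<And>x. (D has_real_derivative D' x) (at x)"
    and bound: "\<And>x. \<bar>D' x\<bar> \<le> d"
    and mean: "(D has_integral 0) {0..2 * pi}"
    and x: "x \<in> {0..2 * pi}"
  shows "\<bar>D x\<bar> \<le> 2 * pi * d"
proof -
  have d: "0 \<le> d" using bound[of 0] by linarith
  have lip: "\<bar>D x - D y\<bar> \<le> 2 * pi * d" if "y \<in> {0..2 * pi}" for y
  proof -
    have "\<bar>D x - D y\<bar> \<le> d * \<bar>x - y\<bar>"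
      using field_differentiable_bound[of UNIV D D' d x y] deriv bound by auto
    also have "\<dots> \<le> d * (2 * pi)" using x that d by (intro mult_left_mono) auto
    finally show ?thesis by (simp add: mult_ac)
  qed
  have "((\<lambda>y. D x - D y) has_integral D x * (2 * pi) - 0) {0..2 * pi}"
    using has_integral_diff[OF has_integral_const_real[of "D x" 0 "2 * pi"] mean] by simp (simp add: mult_ac)
  then have "\<bar>D x * (2 * pi) - 0\<bar> \<le> (2 * pi * d) * (2 * pi)"
    by (rule has_integral_abs_bound) (rule lip)
  then have "2 * pi * \<bar>D x\<bar> \<le> 2 * pi * (2 * pi * d)" by (simp add: abs_mult mult_ac)
  then show ?thesis by simp
qed

lemma uniform_limit_square_integral:
  fixes F :: "nat \<Rightarrow> real \<Rightarrow> real"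
  assumes lim: "uniform_limit {0..2 * pi} F f sequentially"
    and cont: "\<And>k. continuous_on {0..2 * pi} (F k)"
  shows "(\<lambda>k. integral {0..2 * pi} (\<lambda>t. (F k t)\<^sup>2)) \<longlonglongrightarrow> integral {0..2 * pi} (\<lambda>t. (f t)\<^sup>2)"
proof -
  have f: "continuous_on {0..2 * pi} f"
    using uniform_limit_theorem[OF _ lim] cont by simp
  then have bf: "bounded (f ` {0..2 * pi})"
    by (intro compact_imp_bounded compact_continuous_image) auto
  have "uniform_limit {0..2 * pi} (\<lambda>k t. F k t * F k t) (\<lambda>t. f t * f t) sequentially"
    by (rule uniform_lim_mult[OF lim lim bf bf])
  then have L: "uniform_limit {0..2 * pi} (\<lambda>k t. (F k t)\<^sup>2) (\<lambda>t. (f t)\<^sup>2) sequentially"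
    by (simp add: power2_eq_square)
  obtain I J where IJ: "\<And>k. ((\<lambda>t. (F k t)\<^sup>2) has_integral I k) {0..2 * pi}"
    "((\<lambda>t. (f t)\<^sup>2) has_integral J) {0..2 * pi}" "(I \<longlongrightarrow> J) sequentially"
    using uniform_limit_integral[OF L] cont by (metis continuous_on_power trivial_limit_sequentially)
  have "I = (\<lambda>k. integral {0..2 * pi} (\<lambda>t. (F k t)\<^sup>2))"
    by (intro ext integral_unique[symmetric] IJ(1))
  moreover have "J = integral {0..2 * pi} (\<lambda>t. (f t)\<^sup>2)"
    using IJ(2) by (simp add: integral_unique)
  ultimately show ?thesis using IJ(3) by simp
qed

section \<open>Wirtinger inequalities for symmetric periodic functions\<close>

text \<open>
  The number \<open>c\<close> encodes both the parity under the shift by \<open>\<pi>\<close> and, as the mean and the first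
  harmonic vanish, the smallest frequency that can occur in \<open>f\<close>.
\<close>

locale symmetric_orthogonal =
  fixes f f' :: "real \<Rightarrow> real" and c :: nat
  assumes deriv: "\<And>x. (f has_real_derivative f' x) (at x)"
    and cont': "continuous_on UNIV f'"
    and c: "c = 2 \<or> c = 3"
    and sym: "\<And>x. f (x + pi) = (-1) ^ c * f x"
    and mean: "(f has_integral 0) {0..2 * pi}"
    and orth_cos: "((\<lambda>x. f x * cos x) has_integral 0) {0..2 * pi}"
    and orth_sin: "((\<lambda>x. f x * sin x) has_integral 0) {0..2 * pi}"
begin

lemma cont: "continuous_on S f"
  using deriv by (meson DERIV_isCont continuous_at_imp_continuous_on)

lemma periodic: "f (x + 2 * pi) = f x"
  using sym[of x] sym[of "x + pi"] c by (auto simp: add.assoc)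

lemma sym': "f' (x + pi) = (-1) ^ c * f' x"
  by (rule derivative_shift[OF deriv sym])

lemma deriv_orthogonal:
  "(f' has_integral 0) {0..2 * pi}"
  "((\<lambda>x. f' x * cos x) has_integral 0) {0..2 * pi}"
  "((\<lambda>x. f' x * sin x) has_integral 0) {0..2 * pi}"
proof -
  have p: "f (2 * pi) = f 0" using periodic[of 0] by simp
  note i = fundamental_theorem_of_calculus[of 0 "2 * pi"]
  have d: "(f has_vector_derivative f' x) (at x within {0..2 * pi})" for x
    using deriv has_field_derivative_at_within has_real_derivative_iff_has_vector_derivative by blast
  show "(f' has_integral 0) {0..2 * pi}" using i[of f f'] d p by simp
  have "((\<lambda>x. f x * cos x) has_vector_derivative (f' x * cos x - f x * sin x)) (at x within {0..2 * pi})" for x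
    unfolding has_real_derivative_iff_has_vector_derivative[symmetric]
    by (auto intro!: derivative_eq_intros has_field_derivative_at_within[OF deriv])
  then have "((\<lambda>x. f' x * cos x - f x * sin x) has_integral f (2 * pi) * cos (2 * pi) - f 0 * cos 0) {0..2 * pi}"
    by (intro i) auto
  from has_integral_add[OF this orth_sin] show "((\<lambda>x. f' x * cos x) has_integral 0) {0..2 * pi}"
    using p by simp
  have "((\<lambda>x. f x * sin x) has_vector_derivative (f' x * sin x + f x * cos x)) (at x within {0..2 * pi})" for x
    unfolding has_real_derivative_iff_has_vector_derivative[symmetric]
    by (auto intro!: derivative_eq_intros has_field_derivative_at_within[OF deriv])
  then have "((\<lambda>x. f' x * sin x + f x * cos x) has_integral f (2 * pi) * sin (2 * pi) - f 0 * sin 0) {0..2 * pi}"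
    by (intro i) auto
  from has_integral_diff[OF this orth_cos] show "((\<lambda>x. f' x * sin x) has_integral 0) {0..2 * pi}"
    by simp
qed

text \<open>
  The derivative is approximated and the result integrated term by term; the lack of a constant
  term makes this possible within trigonometric polynomials.
\<close>

lemma C1_trig_approx:
  assumes e: "e > 0"
  obtains N a b where "finite N" "\<And>n. n \<in> N \<Longrightarrow> c \<le> n \<and> (even n \<longleftrightarrow> even c)"
    "\<And>x. x \<in> {0..2 * pi} \<Longrightarrow> \<bar>trig_sum N a b x - f x\<bar> \<le> e"
    "\<And>x. x \<in> {0..2 * pi} \<Longrightarrow> \<bar>trig_sum N (\<lambda>n. real n * b n) (\<lambda>n. - real n * a n) x - f' x\<bar> \<le> e"
proof -
  define d where "d = e / (1 + 2 * pi)"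
  have pos: "0 < 1 + 2 * pi" using pi_gt_zero by linarith
  have d: "d > 0" using e pos by (simp add: d_def)
  have "d * (1 + 2 * pi) = e" using pos by (simp add: d_def)
  then have sum: "d + 2 * pi * d = e" by (simp add: algebra_simps)
  have "0 < 2 * pi * d" using d by simp
  with sum d have de: "d \<le> e" "2 * pi * d \<le> e" by linarith+
  have \<sigma>: "(-1) ^ c = (1::real) \<or> (-1) ^ c = (-1::real)" by (cases "even c") auto
  obtain N a' b' where N: "finite N" "\<And>n. n \<in> N \<Longrightarrow> 2 \<le> n \<and> (-1) ^ n = ((-1) ^ c :: real)"
    "\<And>x. \<bar>f' x - trig_sum N a' b' x\<bar> \<le> d"
    using symmetric_trig_approx[OF cont' \<sigma> sym' deriv_orthogonal d] by metis
  \<comment> \<open>The coefficients of the antiderivative of \<open>trig_sum N a' b'\<close>.\<close>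
  define a where "a = (\<lambda>n. - b' n / real n)"
  define b where "b = (\<lambda>n. a' n / real n)"
  have T': "trig_sum N (\<lambda>n. real n * b n) (\<lambda>n. - real n * a n) = trig_sum N a' b'"
    unfolding trig_sum_def fun_eq_iff
    by (intro allI sum.cong refl) (use N(2) in \<open>force simp: a_def b_def\<close>)
  have N0: "0 \<notin> N" using N(2)[of 0] by auto
  have "((\<lambda>x. trig_sum N a b x) has_integral 0) {0..2 * pi}"
    using has_integral_trig_sum_cos[OF N(1), of a b 0] N0 by simp
  from has_integral_diff[OF this mean]
  have mean': "((\<lambda>x. trig_sum N a b x - f x) has_integral 0) {0..2 * pi}" by simp
  have "((\<lambda>x. trig_sum N a b x - f x) has_real_derivative trig_sum N a' b' x - f' x) (at x)" for x
    using DERIV_diff[OF trig_sum_has_derivative deriv] T' by metis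
  from mean_zero_bound[OF this _ mean', of d] N(3)
  have "\<bar>trig_sum N a b x - f x\<bar> \<le> 2 * pi * d" if "x \<in> {0..2 * pi}" for x
    using that by (simp add: abs_minus_commute)
  with de have D: "\<bar>trig_sum N a b x - f x\<bar> \<le> e" if "x \<in> {0..2 * pi}" for x
    using that order_trans by blast
  have par: "c \<le> n \<and> (even n \<longleftrightarrow> even c)" if "n \<in> N" for n
  proof -
    have "even n \<longleftrightarrow> even c" using N(2)[OF that] by (auto simp: minus_one_power_iff split: if_splits)
    moreover have "c \<le> n" using N(2)[OF that] c calculation by (cases "n = 2") auto
    ultimately show ?thesis by simp
  qed
  have "\<bar>trig_sum N (\<lambda>n. real n * b n) (\<lambda>n. - real n * a n) x - f' x\<bar> \<le> e" for x
    unfolding T' using N(3)[of x] de by (simp add: abs_minus_commute)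
  with N(1) par D show ?thesis by (intro that[of N a b]) auto
qed

definition energy :: real where
  "energy = integral {0..2 * pi} (\<lambda>t. (f' t)\<^sup>2) - integral {0..2 * pi} (\<lambda>t. (f t)\<^sup>2)"

text \<open>
  The inequalities for trigonometric polynomials survive uniform limits of functions together with
  their derivatives.
\<close>

lemma energy_bounds:
  shows energy_sup_bound: "\<And>x. x \<in> {0..2 * pi} \<Longrightarrow> 2 * pi * (real c - 1) * (f x)\<^sup>2 \<le> energy"
    and energy_square_bound: "((real c)\<^sup>2 - 1) * integral {0..2 * pi} (\<lambda>t. (f t)\<^sup>2) \<le> energy"
proof -
  have c2: "2 \<le> c" using c by auto
  define good where "good = (\<lambda>k N a b. finite N \<and> (\<forall>n\<in>N. c \<le> n \<and> (even n \<longleftrightarrow> even c)) \<and>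
    (\<forall>x\<in>{0..2 * pi}. \<bar>trig_sum N a b x - f x\<bar> \<le> 1 / real (Suc k)) \<and>
    (\<forall>x\<in>{0..2 * pi}. \<bar>trig_sum N (\<lambda>n. real n * b n) (\<lambda>n. - real n * a n) x - f' x\<bar> \<le> 1 / real (Suc k)))"
  have "\<exists>N a b. good k N a b" for k
  proof -
    have "1 / real (Suc k) > 0" by simp
    then show ?thesis
    proof (rule C1_trig_approx)
      fix N a b
      assume "finite N" "\<And>n. n \<in> N \<Longrightarrow> c \<le> n \<and> (even n \<longleftrightarrow> even c)"
        "\<And>x. x \<in> {0..2 * pi} \<Longrightarrow> \<bar>trig_sum N a b x - f x\<bar> \<le> 1 / real (Suc k)"
        "\<And>x. x \<in> {0..2 * pi} \<Longrightarrow>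
           \<bar>trig_sum N (\<lambda>n. real n * b n) (\<lambda>n. - real n * a n) x - f' x\<bar> \<le> 1 / real (Suc k)"
      then have "good k N a b" unfolding good_def by blast
      then show ?thesis by blast
    qed
  qed
  then obtain N a b where N: "\<And>k. good k (N k) (a k) (b k)" by metis
  note N = N[unfolded good_def]
  have fin: "finite (N k)" and freq: "\<And>n. n \<in> N k \<Longrightarrow> c \<le> n \<and> (even n \<longleftrightarrow> even c)" for k
    using N[of k] by blast+
  define T where "T = (\<lambda>k. trig_sum (N k) (a k) (b k))"
  define T' where "T' = (\<lambda>k. trig_sum (N k) (\<lambda>n. real n * b k n) (\<lambda>n. - real n * a k n))"
  have unif: "uniform_limit {0..2 * pi} F g sequentially"
    if F: "\<And>k x. x \<in> {0..2 * pi} \<Longrightarrow> \<bar>F k x - g x\<bar> \<le> 1 / real (Suc k)" for F and g :: "real \<Rightarrow> real"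
  proof (rule uniform_limitI)
    fix e :: real assume "e > 0"
    then have "eventually (\<lambda>k. 1 / real (Suc k) < e) sequentially"
      using LIMSEQ_inverse_real_of_nat by (auto simp: inverse_eq_divide intro: order_tendstoD(2))
    then show "\<forall>\<^sub>F k in sequentially. \<forall>x\<in>{0..2 * pi}. dist (F k x) (g x) < e"
      by eventually_elim (auto simp: dist_real_def intro: le_less_trans[OF F])
  qed
  have T: "uniform_limit {0..2 * pi} T f sequentially" unfolding T_def by (rule unif) (use N in blast)
  have T': "uniform_limit {0..2 * pi} T' f' sequentially" unfolding T'_def by (rule unif) (use N in blast)
  have cT: "continuous_on {0..2 * pi} (trig_sum M u v)" for M u v
    unfolding trig_sum_def[abs_def] by (intro continuous_intros)
  define Q where "Q = (\<lambda>k. integral {0..2 * pi} (\<lambda>t. (T' k t)\<^sup>2) - integral {0..2 * pi} (\<lambda>t. (T k t)\<^sup>2))"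
  have IT: "(\<lambda>k. integral {0..2 * pi} (\<lambda>t. (T k t)\<^sup>2)) \<longlonglongrightarrow> integral {0..2 * pi} (\<lambda>t. (f t)\<^sup>2)"
    by (rule uniform_limit_square_integral[OF T]) (simp add: T_def cT)
  have Q: "Q \<longlonglongrightarrow> energy"
    unfolding Q_def energy_def
    by (intro tendsto_diff IT uniform_limit_square_integral[OF T']) (simp add: T'_def cT)
  show "((real c)\<^sup>2 - 1) * integral {0..2 * pi} (\<lambda>t. (f t)\<^sup>2) \<le> energy"
    by (rule LIMSEQ_le[OF tendsto_mult_left[OF IT] Q])
       (unfold Q_def T_def T'_def, intro exI allI impI trig_sum_inequalities(2)[OF fin c2 freq])
  fix x :: real assume x: "x \<in> {0..2 * pi}"
  have "(\<lambda>k. T k x) \<longlonglongrightarrow> f x" using tendsto_uniform_limitI[OF T x] .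
  then have "(\<lambda>k. 2 * pi * (real c - 1) * (T k x)\<^sup>2) \<longlonglongrightarrow> 2 * pi * (real c - 1) * (f x)\<^sup>2"
    by (intro tendsto_intros)
  then show "2 * pi * (real c - 1) * (f x)\<^sup>2 \<le> energy"
    by (rule LIMSEQ_le[OF _ Q])
       (unfold Q_def T_def T'_def, intro exI allI impI trig_sum_inequalities(1)[OF fin c2 freq])
qed

lemma energy_nonneg: "0 \<le> energy"
proof -
  have "0 \<le> integral {0..2 * pi} (\<lambda>t. (f t)\<^sup>2)"
    by (intro integral_nonneg integrable_continuous_real continuous_intros cont) auto
  moreover have "0 < (real c)\<^sup>2 - 1" using c by auto
  ultimately show ?thesis using energy_square_bound by (meson mult_nonneg_nonneg less_imp_le order_trans)
qed

lemma dist_inf_bound: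
  assumes eq: "\<And>\<theta>. support_fun (frontier K) \<theta> - support_fun (frontier N) \<theta> = f \<theta>"
  shows "2 * pi * (real c - 1) * (dist_inf K N)\<^sup>2 \<le> energy"
proof -
  define k where "k = 2 * pi * (real c - 1)"
  have k: "k > 0" using c by (auto simp: k_def)
  have le: "\<bar>f x\<bar> \<le> sqrt (energy / k)" if "x \<in> {0..2 * pi}" for x
    using energy_sup_bound[OF that] k unfolding k_def[symmetric]
    by (intro real_le_rsqrt) (simp add: field_simps)
  have "bdd_above ((\<lambda>\<theta>. \<bar>f \<theta>\<bar>) ` {0..2 * pi})" using le by (intro bdd_aboveI2) auto
  then have "\<bar>f 0\<bar> \<le> dist_inf K N"
    unfolding dist_inf_def eq by (intro cSUP_upper) auto
  then have "0 \<le> dist_inf K N" by linarith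
  moreover have "dist_inf K N \<le> sqrt (energy / k)"
    unfolding dist_inf_def eq by (intro cSUP_least le) auto
  ultimately have "(dist_inf K N)\<^sup>2 \<le> (sqrt (energy / k))\<^sup>2" by (intro power_mono)
  also have "\<dots> = energy / k" using energy_nonneg k by simp
  finally show ?thesis using k unfolding k_def[symmetric] by (simp add: field_simps)
qed

lemma dist_2_bound:
  assumes eq: "\<And>\<theta>. support_fun (frontier K) \<theta> - support_fun (frontier N) \<theta> = f \<theta>"
  shows "((real c)\<^sup>2 - 1) * (dist_2 K N)\<^sup>2 \<le> energy"
proof -
  have "0 \<le> integral {0..2 * pi} (\<lambda>t. (f t)\<^sup>2)"
    by (intro integral_nonneg integrable_continuous_real continuous_intros cont) auto
  then have "(dist_2 K N)\<^sup>2 = integral {0..2 * pi} (\<lambda>t. (f t)\<^sup>2)"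
    unfolding dist_2_def eq by simp
  then show ?thesis using energy_square_bound by simp
qed

lemma periodic': "f' (x + 2 * pi) = f' x"
  using sym'[of x] sym'[of "x + pi"] c by (auto simp: add.assoc)

text \<open>
  Integration by parts; the boundary terms cancel by periodicity. Up to the factor \<open>1/2\<close>, the left
  side is the oriented area of the curve with support function \<open>f\<close>.
\<close>

lemma integral_area_form:
  assumes "\<And>x. (f' has_real_derivative f'' x) (at x)"
  shows "((\<lambda>x. f x * (f x + f'' x)) has_integral - energy) {0..2 * pi}"
proof -
  have "((\<lambda>x. f x * f' x) has_real_derivative (f' x)\<^sup>2 + f x * f'' x) (at x)" for x
    by (auto intro!: derivative_eq_intros deriv assms simp: power2_eq_square)
  from has_integral_derivative[OF this, of 0 "2 * pi"]
  have 1: "((\<lambda>x. (f' x)\<^sup>2 + f x * f'' x) has_integral 0) {0..2 * pi}"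
    using periodic[of 0] periodic'[of 0] by simp
  have 2: "((\<lambda>x. (f x)\<^sup>2) has_integral integral {0..2 * pi} (\<lambda>t. (f t)\<^sup>2)) {0..2 * pi}"
    "((\<lambda>x. (f' x)\<^sup>2) has_integral integral {0..2 * pi} (\<lambda>t. (f' t)\<^sup>2)) {0..2 * pi}"
    by (intro integrable_integral integrable_continuous_real continuous_intros cont
        continuous_on_subset[OF cont'] subset_UNIV)+
  show ?thesis
    using has_integral_add[OF has_integral_diff[OF 1 2(2)] 2(1)]
    by (simp add: energy_def power2_eq_square algebra_simps)
qed

text \<open>
  The operator \<open>f \<mapsto> f + f''\<close> is symmetric and annihilates the first harmonics. Thus the area does
  not change under translations of the curve.
\<close>

lemma integral_translation_form:
  assumes "\<And>x. (f' has_real_derivative f'' x) (at x)"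
  shows "((\<lambda>x. (a * cos x + b * sin x) * (f x + f'' x)) has_integral 0) {0..2 * pi}"
proof -
  have "((\<lambda>x. (a * cos x + b * sin x) * f' x + (a * sin x - b * cos x) * f x) has_real_derivative
      (a * cos x + b * sin x) * (f x + f'' x)) (at x)" for x
    by (auto intro!: derivative_eq_intros deriv assms simp: algebra_simps)
  from has_integral_derivative[OF this, of 0 "2 * pi"] show ?thesis
    using periodic[of 0] periodic'[of 0] by simp
qed

end

section \<open>Convex loops parametrized by the normal angle\<close>

text \<open>
  A closed convex curve with its first two derivatives in coordinates, oriented so that the
  curvature is positive.
\<close>

locale convex_loop =
  fixes x y x1 y1 x2 y2 :: "real \<Rightarrow> real" and T :: real
  assumes T: "T > 0"
    and dx: "\<And>t. (x has_real_derivative x1 t) (at t)"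
    and dy: "\<And>t. (y has_real_derivative y1 t) (at t)"
    and dx1: "\<And>t. (x1 has_real_derivative x2 t) (at t)"
    and dy1: "\<And>t. (y1 has_real_derivative y2 t) (at t)"
    and cx2: "continuous_on UNIV x2" and cy2: "continuous_on UNIV y2"
    and perx: "\<And>t. x (t + T) = x t" and pery: "\<And>t. y (t + T) = y t"
    and inj: "\<And>s t. \<lbrakk>s < t; t < s + T; x s = x t; y s = y t\<rbrakk> \<Longrightarrow> False"
    and curv: "\<And>t. x1 t * y2 t - y1 t * x2 t > 0"
    and conv: "\<And>t. (\<forall>s. x1 t * (y s - y t) - y1 t * (x s - x t) \<ge> 0) \<or>
                    (\<forall>s. x1 t * (y s - y t) - y1 t * (x s - x t) \<le> 0)"
begin

definition speed :: "real \<Rightarrow> real" where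
  "speed t = sqrt ((x1 t)\<^sup>2 + (y1 t)\<^sup>2)"

definition turning :: "real \<Rightarrow> real" where
  "turning t = (x1 t * y2 t - y1 t * x2 t) / ((x1 t)\<^sup>2 + (y1 t)\<^sup>2)"

lemma speed_sq_pos: "(x1 t)\<^sup>2 + (y1 t)\<^sup>2 > 0"
proof -
  have "x1 t \<noteq> 0 \<or> y1 t \<noteq> 0" using curv[of t] by auto
  then show ?thesis by (simp add: sum_power2_gt_zero_iff)
qed

lemma speed_pos: "speed t > 0" using speed_sq_pos by (simp add: speed_def)

lemma speed_sq: "(speed t)\<^sup>2 = (x1 t)\<^sup>2 + (y1 t)\<^sup>2" by (simp add: speed_def)

lemma turning_pos: "turning t > 0"
  unfolding turning_def using curv speed_sq_pos by simp

lemma cont_base: "continuous_on S x1" "continuous_on S y1" "continuous_on S x2" "continuous_on S y2"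
  using dx1 dy1 cx2 cy2 by (meson DERIV_isCont continuous_at_imp_continuous_on continuous_on_subset subset_UNIV)+

lemma cont_speed: "continuous_on S speed"
  unfolding speed_def[abs_def] by (intro continuous_intros cont_base)

lemma cont_turning: "continuous_on S turning"
  unfolding turning_def[abs_def] by (intro continuous_intros cont_base) (use speed_sq_pos in \<open>metis less_irrefl\<close>)

text \<open>
  Positive curvature decides which of the two alternatives of convexity holds: near the point of
  contact the curve lies strictly to the left of its tangent.
\<close>

lemma left_of_tangent: "x1 t * (y s - y t) - y1 t * (x s - x t) \<ge> 0"
proof -
  define E where "E = (\<lambda>s. x1 t * (y s - y t) - y1 t * (x s - x t))"
  define E' where "E' = (\<lambda>s. x1 t * y1 s - y1 t * x1 s)"
  have E: "(E has_real_derivative E' s) (at s)" for s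
    unfolding E_def E'_def by (auto intro!: derivative_eq_intros dx dy)
  have "(E' has_real_derivative x1 t * y2 t - y1 t * x2 t) (at t)"
    unfolding E'_def by (auto intro!: derivative_eq_intros dx1 dy1)
  from DERIV_pos_inc_right[OF this curv] obtain d where d: "d > 0" "\<And>h. \<lbrakk>0 < h; h < d\<rbrakk> \<Longrightarrow> E' t < E' (t + h)"
    by blast
  have E't: "E' t = 0" by (simp add: E'_def)
  obtain z where z: "t < z" "z < t + d / 2" "E (t + d / 2) - E t = (t + d / 2 - t) * E' z"
    using MVT2[of t "t + d / 2" E E'] E d(1) by auto
  have "E' z > 0" using d(2)[of "z - t"] z d(1) E't by simp
  then have "(t + d / 2 - t) * E' z > 0" using d(1) by (intro mult_pos_pos) auto
  moreover have "E t = 0" by (simp add: E_def)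
  ultimately have "E (t + d / 2) > 0" using z(3) by linarith
  then show ?thesis using conv[of t] unfolding E_def by (meson not_le)
qed

text \<open>
  Suppose that the point with parameter \<open>s\<close> lies on the tangent at \<open>t\<close>. Its signed distance to the
  moving tangent, up to the positive speed the function \<open>D\<close>, is nonnegative and vanishes at \<open>t\<close>, so its derivative vanishes there as well.
  Thus the vector between the two points is parallel to the velocity and to the acceleration at \<open>t\<close>,
  which are independent.
\<close>

lemma support_point_unique:
  assumes "x1 t * (y s - y t) - y1 t * (x s - x t) = 0"
  shows "x s = x t" "y s = y t"
proof -
  define D where "D = (\<lambda>r. x1 r * (y s - y r) - y1 r * (x s - x r))"
  have "(D has_real_derivative x2 t * (y s - y t) - y2 t * (x s - x t)) (at t)"
    unfolding D_def by (auto intro!: derivative_eq_intros dx dy dx1 dy1 simp: algebra_simps)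
  moreover have "D t \<le> D r" for r using left_of_tangent[of r s] assms by (simp add: D_def)
  ultimately have e2: "x2 t * (y s - y t) - y2 t * (x s - x t) = 0"
    by (intro DERIV_local_min[of D _ t 1]) auto
  define u v where "u = x s - x t" and "v = y s - y t"
  have "(x1 t * y2 t - y1 t * x2 t) * u = 0" "(x1 t * y2 t - y1 t * x2 t) * v = 0"
    using assms e2 unfolding u_def[symmetric] v_def[symmetric] by algebra+
  then have "u = 0" "v = 0" using curv[of t] by auto
  then show "x s = x t" "y s = y t" by (auto simp: u_def v_def)
qed

lemma derivative_periodic: "x1 (t + T) = x1 t" "y1 (t + T) = y1 t"
  using derivative_shift[OF dx, of T 1] derivative_shift[OF dy, of T 1] perx pery by simp_all

text \<open>
  A lift of the angle of the outer normal: integrating the turning rate from a correct initial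
  value keeps the direction correct, since \<open>b\<close>, the component of the unit tangent in the predicted
  direction, has derivative \<open>0\<close>.
\<close>

lemma angle_exists:
  "\<exists>\<phi>. \<forall>t. (\<phi> has_real_derivative turning t) (at t) \<and>
           x1 t = - speed t * sin (\<phi> t) \<and> y1 t = speed t * cos (\<phi> t)"
proof -
  obtain H where H: "\<And>t. (H has_real_derivative turning t) (at t)"
    using antiderivative_exists[OF cont_turning] by blast
  have "(y1 0 / speed 0)\<^sup>2 + (- x1 0 / speed 0)\<^sup>2 = 1"
  proof -
    have "(y1 0 / speed 0)\<^sup>2 + (- x1 0 / speed 0)\<^sup>2 = ((x1 0)\<^sup>2 + (y1 0)\<^sup>2) / (speed 0)\<^sup>2"
      by (simp add: power_divide add_divide_distrib)
    then show ?thesis using speed_pos[of 0] by (simp flip: speed_sq)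
  qed
  then obtain \<alpha> where \<alpha>: "y1 0 / speed 0 = cos \<alpha>" "- x1 0 / speed 0 = sin \<alpha>"
    using sincos_total_2pi by metis
  define \<phi> where "\<phi> = (\<lambda>t. H t - H 0 + \<alpha>)"
  have \<phi>: "(\<phi> has_real_derivative turning t) (at t)" for t
    unfolding \<phi>_def by (auto intro!: derivative_eq_intros H)
  define b where "b = (\<lambda>t. (- x1 t * sin (\<phi> t) + y1 t * cos (\<phi> t)) / speed t)"
  have ds: "(speed has_real_derivative (x1 t * x2 t + y1 t * y2 t) / speed t) (at t)" for t
  proof -
    have "((\<lambda>t. (x1 t)\<^sup>2 + (y1 t)\<^sup>2) has_real_derivative 2 * (x1 t * x2 t + y1 t * y2 t)) (at t)"
      by (auto intro!: derivative_eq_intros dx1 dy1)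
    from DERIV_chain2[OF DERIV_real_sqrt[OF speed_sq_pos] this]
    have "(speed has_real_derivative inverse (speed t) / 2 * (2 * (x1 t * x2 t + y1 t * y2 t))) (at t)"
      unfolding speed_def[abs_def] .
    moreover have "inverse (speed t) / 2 * (2 * w) = w / speed t" for w
      using speed_pos[of t] by (simp add: field_simps)
    ultimately show ?thesis by metis
  qed
  have db: "(b has_real_derivative 0) (at t)" for t
  proof -
    let ?s = "sin (\<phi> t)" and ?c = "cos (\<phi> t)"
    define v where "v = speed t"
    define w where "w = x1 t * x2 t + y1 t * y2 t"
    define k where "k = turning t"
    define n where "n = - x1 t * ?s + y1 t * ?c"
    define n' where "n' = - x2 t * ?s + y2 t * ?c - k * (x1 t * ?c + y1 t * ?s)"
    have v: "v > 0" "v\<^sup>2 = (x1 t)\<^sup>2 + (y1 t)\<^sup>2" unfolding v_def by (rule speed_pos speed_sq)+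
    have num: "((\<lambda>t. - x1 t * sin (\<phi> t) + y1 t * cos (\<phi> t)) has_real_derivative n') (at t)"
      unfolding n'_def k_def by (auto intro!: derivative_eq_intros dx1 dy1 \<phi> simp: algebra_simps)
    have b': "(b has_real_derivative (n' * v - n * (w / v)) / (v * v)) (at t)"
      using DERIV_divide[OF num ds] v(1) unfolding b_def n_def v_def w_def by simp
    have "k * v\<^sup>2 = x1 t * y2 t - y1 t * x2 t"
      unfolding v(2) k_def turning_def using speed_sq_pos[of t] by simp
    moreover have "n' * v\<^sup>2 = (- x2 t * ?s + y2 t * ?c) * v\<^sup>2 - (k * v\<^sup>2) * (x1 t * ?c + y1 t * ?s)"
      unfolding n'_def by (simp add: algebra_simps)
    ultimately have "n' * v\<^sup>2 = (- x2 t * ?s + y2 t * ?c) * ((x1 t)\<^sup>2 + (y1 t)\<^sup>2)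
        - (x1 t * y2 t - y1 t * x2 t) * (x1 t * ?c + y1 t * ?s)"
      by (simp only: v(2))
    then have "n' * v\<^sup>2 = n * w"
      unfolding n_def w_def by (simp add: power2_eq_square algebra_simps)
    then have "n' * v - n * (w / v) = 0"
      using v(1) by (simp add: field_simps power2_eq_square)
    with b' show ?thesis by simp
  qed
  have b: "b t = 1" for t
  proof -
    have "b t = b 0" using DERIV_isconst_all[of b] db by blast
    also have "b 0 = sin \<alpha> * sin \<alpha> + cos \<alpha> * cos \<alpha>"
      unfolding b_def \<phi>_def \<alpha>[symmetric] by (simp add: \<alpha> add_divide_distrib diff_divide_distrib flip: \<alpha>)
    finally show ?thesis by (simp flip: power2_eq_square)
  qed
  have "x1 t = - speed t * sin (\<phi> t) \<and> y1 t = speed t * cos (\<phi> t)" for t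
  proof -
    let ?s = "sin (\<phi> t)" and ?c = "cos (\<phi> t)" and ?v = "speed t"
    have n: "- x1 t * ?s + y1 t * ?c = ?v" using b[of t] speed_pos[of t] by (simp add: b_def)
    have "(x1 t * ?c + y1 t * ?s)\<^sup>2 + (- x1 t * ?s + y1 t * ?c)\<^sup>2 = ((x1 t)\<^sup>2 + (y1 t)\<^sup>2) * (?s\<^sup>2 + ?c\<^sup>2)"
      by algebra
    then have z: "x1 t * ?c + y1 t * ?s = 0"
      unfolding n by (simp add: speed_sq)
    have "x1 t * (?s\<^sup>2 + ?c\<^sup>2) = ?c * (x1 t * ?c + y1 t * ?s) - ?s * (- x1 t * ?s + y1 t * ?c)"
      "y1 t * (?s\<^sup>2 + ?c\<^sup>2) = ?s * (x1 t * ?c + y1 t * ?s) + ?c * (- x1 t * ?s + y1 t * ?c)"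
      by algebra+
    then show ?thesis unfolding n z by simp
  qed
  with \<phi> show ?thesis by blast
qed

definition angle :: "real \<Rightarrow> real" where
  "angle = (SOME \<phi>. \<forall>t. (\<phi> has_real_derivative turning t) (at t) \<and>
           x1 t = - speed t * sin (\<phi> t) \<and> y1 t = speed t * cos (\<phi> t))"

lemma angle: "(angle has_real_derivative turning t) (at t)"
    "x1 t = - speed t * sin (angle t)" "y1 t = speed t * cos (angle t)"
  using someI_ex[OF angle_exists] unfolding angle_def[symmetric] by blast+

lemma angle_strict_mono: "strict_mono angle"
  by (rule strict_monoI, rule DERIV_pos_imp_increasing) (use angle turning_pos in blast)+

lemma angle_isCont: "isCont angle t"
  using angle(1) DERIV_isCont by blast

lemma angle_cont: "continuous_on S angle"
  using angle_isCont continuous_at_imp_continuous_on by blast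

lemma tangent_det: "x1 t * (y s - y t) - y1 t * (x s - x t) = speed t *
    (x t * cos (angle t) + y t * sin (angle t) - (x s * cos (angle t) + y s * sin (angle t)))"
proof -
  have "(- v * b) * (q - p) - (v * a) * (n - m) = v * (m * a + p * b - (n * a + q * b))"
    for v a b m n p q :: real by (simp add: algebra_simps)
  then show ?thesis by (simp only: angle(2,3)[of t])
qed

lemma support_maximum: "x s * cos (angle t) + y s * sin (angle t) \<le> x t * cos (angle t) + y t * sin (angle t)"
  using left_of_tangent[of t s] speed_pos[of t] unfolding tangent_det by (simp add: zero_le_mult_iff)

text \<open>
  The angle grows by a positive multiple of \<open>2\<pi>\<close>. If it grew by more than \<open>2\<pi>\<close>, the outer normal
  at \<open>t\<close> would recur before the end of the period; both points would then lie on the same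
  supporting line, hence coincide, against injectivity.
\<close>

lemma angle_period: "angle (t + T) = angle t + 2 * pi"
proof -
  have sp: "speed (t + T) = speed t" by (simp add: speed_def derivative_periodic)
  have "sin (angle (t + T)) = sin (angle t)" "cos (angle (t + T)) = cos (angle t)"
    using derivative_periodic[of t] angle(2,3)[of t] angle(2,3)[of "t + T"] speed_pos[of t]
    by (simp_all add: sp)
  then obtain k :: int where k: "angle (t + T) = angle t + 2 * pi * k"
    using sin_cos_eq_iff by blast
  have "angle t < angle (t + T)" using angle_strict_mono T by (simp add: strict_mono_def)
  then have "k > 0" using k by (simp add: zero_less_mult_iff)
  moreover have "\<not> k \<ge> 2"
  proof
    assume "k \<ge> 2"
    then have "2 * pi * 2 \<le> 2 * pi * k" by (intro mult_left_mono) auto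
    then have "angle t + 2 * pi < angle (t + T)" using k pi_gt_zero by linarith
    then obtain r where r: "t \<le> r" "r \<le> t + T" "angle r = angle t + 2 * pi"
      using IVT'[of angle t "angle t + 2 * pi" "t + T"] T angle_cont by auto
    then have r': "t < r" "r < t + T"
      using \<open>angle t + 2 * pi < angle (t + T)\<close> by (auto intro: le_neq_trans)
    have sc: "sin (angle r) = sin (angle t)" "cos (angle r) = cos (angle t)" using r(3) by auto
    have "x t * cos (angle t) + y t * sin (angle t) = x r * cos (angle t) + y r * sin (angle t)"
      using support_maximum[of t r] support_maximum[of r t] unfolding sc by simp
    then have "x1 t * (y r - y t) - y1 t * (x r - x t) = 0"
      unfolding tangent_det by (simp only: diff_self mult_zero_right)
    from support_point_unique[OF this] inj[OF r'] show False by simp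
  qed
  ultimately have "k = 1" by linarith
  then show ?thesis using k by simp
qed

lemma angle_surj: "\<exists>t. angle t = \<theta>"
proof -
  have up: "angle (real n * T) = angle 0 + real n * (2 * pi)" for n
  proof (induction n)
    case (Suc n)
    then show ?case using angle_period[of "real n * T"] by (simp add: algebra_simps)
  qed simp
  have down: "angle (- real n * T) = angle 0 - real n * (2 * pi)" for n
  proof (induction n)
    case (Suc n)
    then show ?case using angle_period[of "- real (Suc n) * T"] by (simp add: algebra_simps)
  qed simp
  obtain n where n: "\<bar>\<theta> - angle 0\<bar> / (2 * pi) < real n" using reals_Archimedean2 by blast
  then have "\<bar>\<theta> - angle 0\<bar> < real n * (2 * pi)" by (simp add: divide_less_eq)
  then have "angle (- real n * T) \<le> \<theta>" "\<theta> \<le> angle (real n * T)" unfolding up down by linarith+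
  moreover have "- real n * T \<le> real n * T" using T by simp
  ultimately show ?thesis
    using IVT'[of angle "- real n * T" \<theta> "real n * T"] angle_cont by blast
qed

definition param :: "real \<Rightarrow> real" where
  "param = inv angle"

lemma angle_param: "angle (param \<theta>) = \<theta>"
  unfolding param_def using angle_surj by (metis f_inv_into_f rangeI)

lemma param_angle: "param (angle t) = t"
  unfolding param_def using angle_strict_mono by (simp add: strict_mono_imp_inj_on)

lemma param_period: "param (\<theta> + 2 * pi) = param \<theta> + T"
  by (metis angle_param angle_period param_angle)

lemma param_isCont: "isCont param \<theta>"
proof -
  have "isCont param (angle (param \<theta>))"
    by (rule isCont_inverse_function[of 1]) (auto simp: param_angle angle_isCont)
  then show ?thesis by (simp add: angle_param)
qed

lemma param_deriv: "(param has_real_derivative inverse (turning (param \<theta>))) (at \<theta>)"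
  by (rule DERIV_inverse_function[where f = angle and a = "\<theta> - 1" and b = "\<theta> + 1"])
     (use turning_pos[of "param \<theta>"] in \<open>auto simp: angle_param param_isCont intro: angle\<close>)

text \<open>
  The support function and its first two derivatives. The first derivative involves no derivative
  of \<open>param\<close> because the velocity is orthogonal to the normal.
\<close>

definition supp where "supp \<theta> = x (param \<theta>) * cos \<theta> + y (param \<theta>) * sin \<theta>"
definition supp' where "supp' \<theta> = - x (param \<theta>) * sin \<theta> + y (param \<theta>) * cos \<theta>"
definition supp'' where "supp'' \<theta> = speed (param \<theta>) / turning (param \<theta>) - supp \<theta>"

lemma support_fun_eq: "support_fun (range (\<lambda>t. (x t, y t))) = supp"
proof
  fix \<theta>
  show "support_fun (range (\<lambda>t. (x t, y t))) \<theta> = supp \<theta>"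
    unfolding support_fun_def unit_dir_def supp_def
  proof (rule cSup_eq_maximum)
    show "x (param \<theta>) * cos \<theta> + y (param \<theta>) * sin \<theta> \<in> (\<lambda>p. p \<bullet> (cos \<theta>, sin \<theta>)) ` range (\<lambda>t. (x t, y t))"
      by (auto simp: image_iff)
    fix z assume "z \<in> (\<lambda>p. p \<bullet> (cos \<theta>, sin \<theta>)) ` range (\<lambda>t. (x t, y t))"
    then obtain s where "z = x s * cos \<theta> + y s * sin \<theta>" by auto
    then show "z \<le> x (param \<theta>) * cos \<theta> + y (param \<theta>) * sin \<theta>"
      using support_maximum[of s "param \<theta>"] by (simp add: angle_param)
  qed
qed

lemma velocity_param: "x1 (param \<theta>) = - speed (param \<theta>) * sin \<theta>" "y1 (param \<theta>) = speed (param \<theta>) * cos \<theta>"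
  using angle(2,3)[of "param \<theta>"] by (simp_all add: angle_param)

lemma supp_deriv: "(supp has_real_derivative supp' \<theta>) (at \<theta>)"
proof -
  let ?i = "inverse (turning (param \<theta>))"
  have "(supp has_real_derivative (x1 (param \<theta>) * ?i * cos \<theta> - x (param \<theta>) * sin \<theta>
     + (y1 (param \<theta>) * ?i * sin \<theta> + y (param \<theta>) * cos \<theta>))) (at \<theta>)"
    unfolding supp_def[abs_def]
    by (auto intro!: derivative_eq_intros DERIV_chain2[OF dx param_deriv] DERIV_chain2[OF dy param_deriv])
  then show ?thesis by (simp add: supp'_def velocity_param algebra_simps)
qed

lemma supp'_deriv: "(supp' has_real_derivative supp'' \<theta>) (at \<theta>)"
proof -
  let ?i = "inverse (turning (param \<theta>))"
  have "(supp' has_real_derivative (- x1 (param \<theta>) * ?i * sin \<theta> - x (param \<theta>) * cos \<theta>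
     + (y1 (param \<theta>) * ?i * cos \<theta> - y (param \<theta>) * sin \<theta>))) (at \<theta>)"
    unfolding supp'_def[abs_def]
    by (auto intro!: derivative_eq_intros DERIV_chain2[OF dx param_deriv] DERIV_chain2[OF dy param_deriv])
  moreover have "- x1 (param \<theta>) * ?i * sin \<theta> - x (param \<theta>) * cos \<theta>
     + (y1 (param \<theta>) * ?i * cos \<theta> - y (param \<theta>) * sin \<theta>) =
     speed (param \<theta>) * ?i * ((sin \<theta>)\<^sup>2 + (cos \<theta>)\<^sup>2) - supp \<theta>"
    unfolding velocity_param supp_def by algebra
  ultimately show ?thesis by (simp add: supp''_def divide_inverse)
qed

lemma supp''_cont: "continuous_on UNIV supp''"
proof -
  have p: "continuous_on UNIV param" using param_isCont continuous_at_imp_continuous_on by blast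
  have q: "continuous_on UNIV supp" using supp_deriv by (meson DERIV_isCont continuous_at_imp_continuous_on)
  show ?thesis unfolding supp''_def[abs_def]
    by (intro continuous_intros q continuous_on_compose2[OF cont_speed p] continuous_on_compose2[OF cont_turning p])
       (auto simp: less_imp_neq[OF turning_pos, symmetric])
qed

text \<open>
  Cauchy's formula: \<open>supp + supp''\<close> is the speed of the curve reparametrized by the normal angle,
  and \<open>supp''\<close> integrates to \<open>0\<close> over a period.
\<close>

lemma length_eq: "integral {0..T} speed = integral {0..2 * pi} supp"
proof -
  obtain \<Lambda> where \<Lambda>: "\<And>t. (\<Lambda> has_real_derivative speed t) (at t)"
    using antiderivative_exists[OF cont_speed] by blast
  have "((\<lambda>t. \<Lambda> (t + T) - \<Lambda> t) has_real_derivative 0) (at t)" for t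
  proof -
    have "((\<lambda>t. \<Lambda> (t + T)) has_real_derivative speed (t + T) * 1) (at t)"
      by (intro DERIV_chain2[OF \<Lambda>]) (auto intro!: derivative_eq_intros)
    from DERIV_diff[OF this \<Lambda>[of t]] show ?thesis by (simp add: speed_def derivative_periodic)
  qed
  then have const: "\<Lambda> (t + T) - \<Lambda> t = \<Lambda> T - \<Lambda> 0" for t
    using DERIV_isconst_all[of "\<lambda>t. \<Lambda> (t + T) - \<Lambda> t" t 0] by simp
  define F where "F = (\<lambda>\<theta>. \<Lambda> (param \<theta>) - supp' \<theta>)"
  have "(F has_real_derivative supp \<theta>) (at \<theta>)" for \<theta>
  proof -
    have "(F has_real_derivative (speed (param \<theta>) * inverse (turning (param \<theta>)) - supp'' \<theta>)) (at \<theta>)"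
      unfolding F_def by (intro DERIV_diff DERIV_chain2[OF \<Lambda> param_deriv] supp'_deriv)
    then show ?thesis by (simp add: supp''_def divide_inverse)
  qed
  then have "(supp has_integral F (2 * pi) - F 0) {0..2 * pi}"
    by (intro fundamental_theorem_of_calculus)
       (auto simp: has_real_derivative_iff_has_vector_derivative[symmetric] intro: has_field_derivative_at_within)
  moreover have "F (2 * pi) - F 0 = \<Lambda> T - \<Lambda> 0"
    using param_period[of 0] const[of "param 0"] perx pery by (simp add: F_def supp'_def)
  moreover have "(speed has_integral \<Lambda> T - \<Lambda> 0) {0..T}"
    by (intro fundamental_theorem_of_calculus)
       (use T \<Lambda> in \<open>auto simp: has_real_derivative_iff_has_vector_derivative[symmetric] intro: has_field_derivative_at_within\<close>)
  ultimately show ?thesis by (simp add: integral_unique)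
qed

lemma length_pos: "integral {0..T} speed > 0"
proof -
  have "0 \<le> integral {0..T} speed"
    using integral_nonneg[OF integrable_continuous_real[OF cont_speed]] speed_pos by (simp add: less_imp_le)
  moreover have "integral {0..T} speed \<noteq> 0"
  proof
    assume "integral {0..T} speed = 0"
    moreover have "(speed has_integral integral {0..T} speed) (cbox 0 T)"
      using integrable_integral[OF integrable_continuous_real[OF cont_speed]] by simp
    ultimately have "speed 0 = 0"
      using has_integral_0_cbox_imp_0[of 0 T speed 0] cont_speed speed_pos T by (simp add: less_imp_le)
    then show False using speed_pos[of 0] by simp
  qed
  ultimately show ?thesis by simp
qed

end

lemma has_real_derivative_components:
  fixes g :: "real \<Rightarrow> plane"
  assumes "(g has_vector_derivative v) (at t)"
  shows "((\<lambda>t. fst (g t)) has_real_derivative fst v) (at t)" "((\<lambda>t. snd (g t)) has_real_derivative snd v) (at t)"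
  using bounded_linear.has_vector_derivative[OF bounded_linear_fst assms]
    bounded_linear.has_vector_derivative[OF bounded_linear_snd assms]
  by (simp_all add: has_real_derivative_iff_has_vector_derivative)

lemma DERIV_reflect:
  fixes f :: "real \<Rightarrow> real"
  assumes "\<And>t. (f has_real_derivative f' t) (at t)"
  shows "((\<lambda>t. f (T - t)) has_real_derivative - f' (T - t)) (at t)"
proof -
  have "((\<lambda>t. f (T - t)) has_real_derivative f' (T - t) * (-1)) (at t)"
    by (intro DERIV_chain2[OF assms]) (auto intro!: derivative_eq_intros)
  then show ?thesis by simp
qed

text \<open>
  A parametrization of negative curvature is run backwards, \<open>t \<mapsto> g(T - t)\<close>; this changes neither
  the trace nor the length.
\<close>

lemma convex_loop_if_oval_param:
  assumes "oval_param g T"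
  shows "\<exists>x y x1 y1 x2 y2. convex_loop x y x1 y1 x2 y2 T \<and> range (\<lambda>t. (x t, y t)) = range g \<and>
           integral {0..T} (convex_loop.speed x1 y1) = integral {0..T} (\<lambda>t. norm (curve_deriv g t))"
proof -
  define g1 where "g1 = curve_deriv g"
  define g2 where "g2 = curve_deriv g1"
  have g1_at: "vector_derivative g (at t) = g1 t" and g2_at: "vector_derivative g1 (at t) = g2 t" for t
    by (simp_all add: g1_def g2_def)
  from assms have T: "T > 0" and sm: "smooth_curve g" and per: "\<And>t. g (t + T) = g t"
    and inj0: "inj_on g {0..<T}" and nz: "\<And>t. g1 t \<noteq> 0" and conv: "convex_curve g"
    and curv: "(\<forall>t. signed_curvature g t > 0) \<or> (\<forall>t. signed_curvature g t < 0)"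
    unfolding oval_param_def g1_def by auto
  have "g differentiable (at t)" "g1 differentiable (at t)" "g2 differentiable (at t)" for t
    using sm[unfolded smooth_curve_def, rule_format, of 0 t] sm[unfolded smooth_curve_def, rule_format, of 1 t]
      sm[unfolded smooth_curve_def, rule_format, of 2 t]
    by (simp_all add: g1_def g2_def numeral_2_eq_2)
  note df = this
  have d: "(g has_vector_derivative g1 t) (at t)" "(g1 has_vector_derivative g2 t) (at t)" for t
    using df unfolding g2_def g1_def by (simp_all only: vector_derivative_works[symmetric])
  have c2: "continuous_on UNIV g2"
    using df(3) by (intro continuous_at_imp_continuous_on ballI differentiable_imp_continuous_within)
  note dg = has_real_derivative_components[OF d(1)] has_real_derivative_components[OF d(2)]
  have c2': "continuous_on UNIV (\<lambda>t. fst (g2 t))" "continuous_on UNIV (\<lambda>t. snd (g2 t))"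
    using c2 by (intro continuous_intros; simp)+
  have inj: False if st: "s < t" "t < s + T" "g s = g t" for s t
  proof -
    define k where "k = \<lfloor>s / T\<rfloor>"
    define s' t' where "s' = s - of_int k * T" and "t' = t - of_int k * T"
    have gs: "g s' = g s" "g t' = g t"
      using periodic_int_multiple[of g T s' k, OF per] periodic_int_multiple[of g T t' k, OF per]
      by (simp_all add: s'_def t'_def)
    have "of_int k \<le> s / T" "s / T < of_int k + 1" unfolding k_def by linarith+
    then have s': "0 \<le> s'" "s' < T" using T by (simp_all add: s'_def field_simps)
    show False
    proof (cases "t' < T")
      case True
      then have "s' = t'" using inj_onD[OF inj0, of s' t'] s' st gs by (auto simp: s'_def t'_def)
      then show False using st by (simp add: s'_def t'_def)
    next
      case False
      have "g (t' - T) = g t'" using per[of "t' - T"] by simp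
      moreover have "0 \<le> t' - T" "t' - T < s'" using False st by (auto simp: s'_def t'_def)
      ultimately have "t' - T = s'" using inj_onD[OF inj0, of "t' - T" s'] s' st gs by auto
      then show False using \<open>t' - T < s'\<close> by simp
    qed
  qed
  have det_sign: "signed_curvature g t > 0 \<longleftrightarrow> fst (g1 t) * snd (g2 t) - snd (g1 t) * fst (g2 t) > 0"
    "signed_curvature g t < 0 \<longleftrightarrow> fst (g1 t) * snd (g2 t) - snd (g1 t) * fst (g2 t) < 0" for t
    unfolding signed_curvature_def det2_def g1_at g2_at
    using nz[of t] by (simp_all add: zero_less_divide_iff divide_less_0_iff)
  have conv': "(\<forall>s. fst (g1 t) * (snd (g s) - snd (g t)) - snd (g1 t) * (fst (g s) - fst (g t)) \<ge> 0) \<or>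
      (\<forall>s. fst (g1 t) * (snd (g s) - snd (g t)) - snd (g1 t) * (fst (g s) - fst (g t)) \<le> 0)" for t
    using conv unfolding convex_curve_def det2_def g1_at by simp
  have norm_g1: "norm (g1 t) = sqrt ((fst (g1 t))\<^sup>2 + (snd (g1 t))\<^sup>2)" for t
    by (simp add: norm_prod_def)
  have cn: "continuous_on UNIV (\<lambda>t. norm (g1 t))"
    using d(2) by (intro continuous_intros continuous_at_imp_continuous_on) (meson has_vector_derivative_continuous)
  from curv show ?thesis
  proof
    assume pos: "\<forall>t. signed_curvature g t > 0"
    have loop: "convex_loop (\<lambda>t. fst (g t)) (\<lambda>t. snd (g t)) (\<lambda>t. fst (g1 t)) (\<lambda>t. snd (g1 t))
        (\<lambda>t. fst (g2 t)) (\<lambda>t. snd (g2 t)) T"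
    proof (unfold_locales, goal_cases)
      case (10 s t)
      then show ?case using inj[of s t] by (simp add: prod_eq_iff)
    qed (use T dg c2' conv' pos in \<open>auto simp: per det_sign\<close>)
    show ?thesis
      by (intro exI conjI, rule loop)
         (simp_all add: convex_loop.speed_def[OF loop, abs_def] norm_g1 g1_at)
  next
    assume neg: "\<forall>t. signed_curvature g t < 0"
    have r: "T - (t + T) = (T - t) - T" for t by simp
    have per': "g (T - (t + T)) = g (T - t)" for t using per[of "- t"] by (simp add: add.commute)
    have inj': "False" if "s < t" "t < s + T" "g (T - s) = g (T - t)" for s t
      using inj[of "T - t" "T - s"] that by simp
    have e1: "((\<lambda>t. fst (g (T - t))) has_real_derivative - fst (g1 (T - t))) (at t)"
      "((\<lambda>t. snd (g (T - t))) has_real_derivative - snd (g1 (T - t))) (at t)"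
      "((\<lambda>t. - fst (g1 (T - t))) has_real_derivative fst (g2 (T - t))) (at t)"
      "((\<lambda>t. - snd (g1 (T - t))) has_real_derivative snd (g2 (T - t))) (at t)" for t
      using DERIV_reflect[OF dg(1), of T t] DERIV_reflect[OF dg(2), of T t]
        DERIV_minus[OF DERIV_reflect[OF dg(3), of T t]] DERIV_minus[OF DERIV_reflect[OF dg(4), of T t]]
      by simp_all
    have c: "continuous_on UNIV (\<lambda>t. fst (g2 (T - t)))" "continuous_on UNIV (\<lambda>t. snd (g2 (T - t)))"
      by (rule continuous_on_compose2[OF c2'(1)] continuous_on_compose2[OF c2'(2)]; auto intro!: continuous_intros)+
    have loop: "convex_loop (\<lambda>t. fst (g (T - t))) (\<lambda>t. snd (g (T - t)))
        (\<lambda>t. - fst (g1 (T - t))) (\<lambda>t. - snd (g1 (T - t)))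
        (\<lambda>t. fst (g2 (T - t))) (\<lambda>t. snd (g2 (T - t))) T"
    proof (unfold_locales, goal_cases)
      case (10 s t)
      then show ?case using inj'[of s t] by (simp add: prod_eq_iff)
    next
      case (11 t)
      then show ?case using neg det_sign(2)[of "T - t"] by simp
    next
      case (12 t)
      have "(\<forall>s. Q (T - s)) \<longleftrightarrow> (\<forall>s. Q s)" for Q :: "real \<Rightarrow> bool"
        by (metis diff_diff_eq2 add_diff_cancel_left')
      then show ?case using conv'[of "T - t"] by (smt (verit) minus_mult_left)
    qed (use T e1 c per' in auto)
    obtain \<Lambda> where \<Lambda>: "\<And>t. (\<Lambda> has_real_derivative norm (g1 t)) (at t)"
      using antiderivative_exists[OF cn] by blast
    have "((\<lambda>t. - \<Lambda> (T - t)) has_real_derivative norm (g1 (T - t))) (at t)" for t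
      using DERIV_minus[OF DERIV_reflect[OF \<Lambda>, of T t]] by simp
    from has_integral_derivative[OF this, of 0 T] has_integral_derivative[OF \<Lambda>, of 0 T] T
    have len: "integral {0..T} (\<lambda>t. norm (g1 (T - t))) = integral {0..T} (\<lambda>t. norm (g1 t))"
      by (simp add: integral_unique)
    have ran: "range (\<lambda>t. g (T - t)) = range g"
    proof -
      have "g t \<in> range (\<lambda>t. g (T - t))" for t by (rule range_eqI[of _ _ "T - t"]) simp
      then show ?thesis by auto
    qed
    show ?thesis
      by (intro exI conjI, rule loop)
         (simp_all add: convex_loop.speed_def[OF loop, abs_def] ran len g1_at flip: norm_g1)
  qed
qed

text \<open>
  Every parametrization yields the same integral of the support function as its length, so this
  also shows that the length of an oval is well defined.
\<close>

lemma oval_support_fun: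
  assumes "oval M"
  obtains p' p'' where "\<And>\<theta>. (support_fun M has_real_derivative p' \<theta>) (at \<theta>)"
    "\<And>\<theta>. (p' has_real_derivative p'' \<theta>) (at \<theta>)" "continuous_on UNIV p''"
    "oval_length M = integral {0..2 * pi} (support_fun M)" "oval_length M > 0"
proof -
  have len: "integral {0..T} (\<lambda>t. norm (curve_deriv g t)) = integral {0..2 * pi} (support_fun M)"
    if gT: "oval_param g T" "M = range g" for g T
  proof -
    obtain x y x1 y1 x2 y2 where "convex_loop x y x1 y1 x2 y2 T"
      and r: "range (\<lambda>t. (x t, y t)) = range g"
      and i: "integral {0..T} (convex_loop.speed x1 y1) = integral {0..T} (\<lambda>t. norm (curve_deriv g t))"
      using convex_loop_if_oval_param[OF gT(1)] by blast
    then interpret convex_loop x y x1 y1 x2 y2 T by simp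
    show ?thesis using length_eq support_fun_eq i r gT(2) by simp
  qed
  obtain g T where gT: "oval_param g T" "M = range g" using assms unfolding oval_def by blast
  have L: "oval_length M = integral {0..2 * pi} (support_fun M)"
    unfolding oval_length_def using gT len by (intro the_equality) metis+
  obtain x y x1 y1 x2 y2 where "convex_loop x y x1 y1 x2 y2 T"
    and r: "range (\<lambda>t. (x t, y t)) = range g"
    using convex_loop_if_oval_param[OF gT(1)] by blast
  then interpret convex_loop x y x1 y1 x2 y2 T by simp
  have p: "support_fun M = supp" using support_fun_eq r gT(2) by simp
  show ?thesis
  proof (rule that[of supp' supp''])
    show "oval_length M > 0" using L length_pos length_eq p by simp
  qed (use p L supp_deriv supp'_deriv supp''_cont in auto)
qed

section \<open>Curves with a given support function\<close>

lemma support_curve_deriv: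
  assumes "\<And>\<theta>. (p has_real_derivative p' \<theta>) (at \<theta>)" "\<And>\<theta>. (p' has_real_derivative p'' \<theta>) (at \<theta>)"
  shows "support_curve p = (\<lambda>\<theta>. (p \<theta> * cos \<theta> - p' \<theta> * sin \<theta>, p \<theta> * sin \<theta> + p' \<theta> * cos \<theta>))"
    and "curve_deriv (support_curve p) \<theta> = (p \<theta> + p'' \<theta>) *\<^sub>R (- sin \<theta>, cos \<theta>)"
proof -
  have "deriv p = p'" using assms(1) DERIV_imp_deriv by blast
  then show eq: "support_curve p = (\<lambda>\<theta>. (p \<theta> * cos \<theta> - p' \<theta> * sin \<theta>, p \<theta> * sin \<theta> + p' \<theta> * cos \<theta>))"
    by (simp add: support_curve_def fun_eq_iff)
  have "((\<lambda>\<theta>. p \<theta> * cos \<theta> - p' \<theta> * sin \<theta>) has_real_derivative (p \<theta> + p'' \<theta>) * - sin \<theta>) (at \<theta>)"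
    "((\<lambda>\<theta>. p \<theta> * sin \<theta> + p' \<theta> * cos \<theta>) has_real_derivative (p \<theta> + p'' \<theta>) * cos \<theta>) (at \<theta>)"
    by (auto intro!: derivative_eq_intros assms simp: algebra_simps)
  then have "(support_curve p has_vector_derivative ((p \<theta> + p'' \<theta>) * - sin \<theta>, (p \<theta> + p'' \<theta>) * cos \<theta>)) (at \<theta>)"
    unfolding eq has_real_derivative_iff_has_vector_derivative by (intro has_vector_derivative_Pair)
  then show "curve_deriv (support_curve p) \<theta> = (p \<theta> + p'' \<theta>) *\<^sub>R (- sin \<theta>, cos \<theta>)"
    by (simp add: vector_derivative_at)
qed

lemma oriented_area_support_curve:
  assumes "\<And>\<theta>. (p has_real_derivative p' \<theta>) (at \<theta>)" "\<And>\<theta>. (p' has_real_derivative p'' \<theta>) (at \<theta>)"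
  shows "oriented_area (support_curve p) a b = integral {a..b} (\<lambda>\<theta>. p \<theta> * (p \<theta> + p'' \<theta>)) / 2"
proof -
  have "- snd (support_curve p \<theta>) * fst (curve_deriv (support_curve p) \<theta>)
      + fst (support_curve p \<theta>) * snd (curve_deriv (support_curve p) \<theta>) = p \<theta> * (p \<theta> + p'' \<theta>)" for \<theta>
  proof -
    have "- (u * s + v * c) * (w * - s) + (u * c - v * s) * (w * c) = u * w * (s\<^sup>2 + c\<^sup>2)" for u v w s c :: real
      by (simp add: power2_eq_square algebra_simps)
    from this[of "p \<theta>" "sin \<theta>" "p' \<theta>" "cos \<theta>" "p \<theta> + p'' \<theta>"] show ?thesis
      unfolding support_curve_deriv(2)[OF assms] by (simp add: support_curve_deriv(1)[OF assms])
  qed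
  then show ?thesis unfolding oriented_area_def by simp
qed

text \<open>
  The tangent at angle \<open>\<theta>\<close> is perpendicular to \<open>unit_dir \<theta>\<close> and at signed distance \<open>h \<theta>\<close> from the
  origin. By convexity the curve lies on one side of it, and positive width rules out the outer
  side, since the point at angle \<open>\<theta> + pi\<close> lies on the inner one.
\<close>

lemma support_fun_support_curve:
  assumes d: "\<And>\<theta>. (h has_real_derivative h' \<theta>) (at \<theta>)" "\<And>\<theta>. (h' has_real_derivative h'' \<theta>) (at \<theta>)"
    and width: "\<And>\<theta>. h \<theta> + h (\<theta> + pi) > 0"
    and oval: "oval_param (support_curve h) (2 * pi)"
  shows "support_fun (range (support_curve h)) = h"
proof
  fix \<theta>
  define w where "w = h \<theta> + h'' \<theta>"
  note sc = support_curve_deriv[OF d]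
  have c: "support_curve h \<phi> \<bullet> unit_dir \<phi> = h \<phi>" for \<phi>
  proof -
    have "(u * c - v * s) * c + (u * s + v * c) * s = u * (s\<^sup>2 + c\<^sup>2)" for u v s c :: real
      by (simp add: power2_eq_square algebra_simps)
    then show ?thesis by (simp add: sc(1) unit_dir_def)
  qed
  have det: "det2 (curve_deriv (support_curve h) \<theta>) (support_curve h \<phi> - support_curve h \<theta>)
     = w * (h \<theta> - support_curve h \<phi> \<bullet> unit_dir \<theta>)" for \<phi>
  proof -
    have "det2 (curve_deriv (support_curve h) \<theta>) (z - z') = w * (z' \<bullet> unit_dir \<theta> - z \<bullet> unit_dir \<theta>)" for z z'
      unfolding sc(2) w_def[symmetric] by (simp add: det2_def unit_dir_def inner_prod_def algebra_simps)
    then show ?thesis by (simp only: c)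
  qed
  have wnz: "w \<noteq> 0"
  proof
    assume "w = 0"
    then have "curve_deriv (support_curve h) \<theta> = 0" by (simp add: sc(2) w_def zero_prod_def)
    then show False using oval unfolding oval_param_def by blast
  qed
  have "(\<forall>\<phi>. w * (h \<theta> - support_curve h \<phi> \<bullet> unit_dir \<theta>) \<ge> 0) \<or>
        (\<forall>\<phi>. w * (h \<theta> - support_curve h \<phi> \<bullet> unit_dir \<theta>) \<le> 0)"
    using oval unfolding oval_param_def convex_curve_def det[symmetric] by blast
  then have "(\<forall>\<phi>. h \<theta> - support_curve h \<phi> \<bullet> unit_dir \<theta> \<ge> 0) \<or> (\<forall>\<phi>. h \<theta> - support_curve h \<phi> \<bullet> unit_dir \<theta> \<le> 0)"
    using wnz by (cases "w > 0") (auto simp: zero_le_mult_iff mult_le_0_iff not_less dest: le_neq_trans)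
  moreover have "h \<theta> - support_curve h (\<theta> + pi) \<bullet> unit_dir \<theta> > 0"
  proof -
    have "unit_dir \<theta> = - unit_dir (\<theta> + pi)" by (simp add: unit_dir_def)
    then show ?thesis using c[of "\<theta> + pi"] width[of \<theta>] by simp
  qed
  ultimately have max: "support_curve h \<phi> \<bullet> unit_dir \<theta> \<le> h \<theta>" for \<phi> by (meson diff_ge_0_iff_ge not_le)
  show "support_fun (range (support_curve h)) \<theta> = h \<theta>"
    unfolding support_fun_def
  proof (rule cSup_eq_maximum)
    show "h \<theta> \<in> (\<lambda>x. x \<bullet> unit_dir \<theta>) ` range (support_curve h)" using c[of \<theta>] by (metis imageI rangeI)
  qed (use max in auto)
qed

lemma support_fun_periodic: "support_fun M (\<theta> + 2 * pi) = support_fun M \<theta>"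
  by (simp add: support_fun_def unit_dir_def)

section \<open>The Steiner symmetral\<close>

lemma norm_unit_dir: "norm (unit_dir \<theta>) = 1"
  by (simp add: unit_dir_def norm_prod_def)

lemma bdd_above_inner: "bdd_above ((\<lambda>x. x \<bullet> v) ` S)" if "bounded (S :: plane set)"
  by (rule bounded_imp_bdd_above) (rule bounded_linear_image[OF that bounded_linear_inner_left])

text \<open>
  From a point of a bounded set, the ray in direction \<open>unit_dir \<theta>\<close> leaves the set through a
  frontier point, and the linear functional increases along it.
\<close>

lemma support_fun_frontier:
  fixes S :: "plane set"
  assumes "bounded S" "S \<noteq> {}"
  shows "support_fun (frontier S) \<theta> = support_fun S \<theta>"
proof -
  let ?u = "unit_dir \<theta>"
  have exit_point: "\<exists>y\<in>frontier S. x \<bullet> ?u \<le> y \<bullet> ?u" if x: "x \<in> S" for x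
  proof -
    let ?R = "(\<lambda>t. x + t *\<^sub>R ?u) ` {0..}"
    have "connected ?R" by (intro connected_continuous_image continuous_intros) (simp add: convex_connected)
    moreover have "?R \<inter> S \<noteq> {}" using x by (force intro: image_eqI[of _ _ 0])
    moreover have "?R - S \<noteq> {}"
    proof -
      obtain B where B: "\<And>y. y \<in> S \<Longrightarrow> norm y \<le> B" using assms(1) bounded_iff by blast
      define t where "t = B + norm x + 1"
      have "0 \<le> B" using B[OF x] norm_ge_zero order_trans by blast
      then have t: "t \<ge> 0" by (simp add: t_def)
      have "norm (t *\<^sub>R ?u) \<le> norm (x + t *\<^sub>R ?u) + norm x" by (metis add_diff_cancel_left' norm_triangle_ineq4)
      then have "norm (x + t *\<^sub>R ?u) > B" using t by (simp add: norm_unit_dir t_def)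
      then have "x + t *\<^sub>R ?u \<notin> S" using B not_le by blast
      then show ?thesis using t by blast
    qed
    ultimately obtain t where t: "t \<ge> 0" "x + t *\<^sub>R ?u \<in> frontier S"
      using connected_Int_frontier by blast
    have "?u \<bullet> ?u = 1" by (simp add: dot_square_norm norm_unit_dir)
    then have "x \<bullet> ?u \<le> (x + t *\<^sub>R ?u) \<bullet> ?u" using t by (simp add: inner_add_left)
    with t show ?thesis by blast
  qed
  have ne: "frontier S \<noteq> {}" using exit_point assms(2) by blast
  have bf: "bounded (frontier S)" using bounded_closure[OF assms(1)] bounded_subset unfolding frontier_def by blast
  show ?thesis unfolding support_fun_def
  proof (rule antisym)
    show "(SUP x\<in>S. x \<bullet> ?u) \<le> (SUP x\<in>frontier S. x \<bullet> ?u)"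
      by (rule cSUP_mono[OF assms(2) bdd_above_inner[OF bf] exit_point])
    have "x \<bullet> ?u \<le> (SUP x\<in>S. x \<bullet> ?u)" if "x \<in> closure S" for x
    proof -
      have "closed {x. x \<bullet> ?u \<le> (SUP x\<in>S. x \<bullet> ?u)}"
        by (intro closed_Collect_le continuous_intros)
      moreover have "S \<subseteq> {x. x \<bullet> ?u \<le> (SUP x\<in>S. x \<bullet> ?u)}"
        using cSUP_upper[OF _ bdd_above_inner[OF assms(1)]] by blast
      ultimately show ?thesis using that closure_minimal by blast
    qed
    then show "(SUP x\<in>frontier S. x \<bullet> ?u) \<le> (SUP x\<in>S. x \<bullet> ?u)"
      by (intro cSUP_least[OF ne]) (simp add: frontier_def)
  qed
qed

lemma support_fun_steiner_symmetral:
  fixes K :: "plane set"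
  assumes "bounded K" "K \<noteq> {}"
  shows "support_fun (frontier (steiner_symmetral K)) \<theta> =
    steiner_point K \<bullet> unit_dir \<theta> + (support_fun (frontier K) \<theta> + support_fun (frontier K) (\<theta> + pi)) / 2"
proof -
  let ?u = "unit_dir \<theta>" and ?s = "steiner_point K" and ?S = "steiner_symmetral K"
  have S: "?S = {?s + (1/2) *\<^sub>R (a - b) | a b. a \<in> K \<and> b \<in> K}"
  proof -
    have diffs: "K + uminus ` K = {a - b | a b. a \<in> K \<and> b \<in> K}"
      unfolding set_plus_def by force
    show ?thesis unfolding steiner_symmetral_def image_image diffs by blast
  qed
  have ne: "?S \<noteq> {}" unfolding S using assms(2) by blast
  have "bounded ((\<lambda>z. (1/2) *\<^sub>R z) ` (\<lambda>(x, y). x + y) ` (K \<times> uminus ` K))"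
    using assms(1) by (intro bounded_scaling bounded_plus) auto
  moreover have "(\<lambda>z. (1/2) *\<^sub>R z) ` (\<lambda>(x, y). x + y) ` (K \<times> uminus ` K) = (\<lambda>z. (1/2) *\<^sub>R z) ` (K + uminus ` K)"
    unfolding set_plus_def by (intro arg_cong[of _ _ "image _"]) force
  ultimately have b: "bounded ?S" unfolding steiner_symmetral_def by (simp add: bounded_translation)
  define P where "P = support_fun K \<theta>"
  define P' where "P' = support_fun K (\<theta> + pi)"
  have u': "unit_dir (\<theta> + pi) = - ?u" by (simp add: unit_dir_def)
  have up: "a \<bullet> ?u \<le> P" "- (a \<bullet> ?u) \<le> P'" if "a \<in> K" for a
    using cSUP_upper[OF that bdd_above_inner[OF assms(1)], of ?u]
      cSUP_upper[OF that bdd_above_inner[OF assms(1)], of "unit_dir (\<theta> + pi)"]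
    unfolding P_def P'_def support_fun_def by (simp_all add: u')
  have "support_fun ?S \<theta> = ?s \<bullet> ?u + (P + P') / 2"
    unfolding support_fun_def
  proof (rule cSup_eq_non_empty)
    show "(\<lambda>x. x \<bullet> ?u) ` ?S \<noteq> {}" using ne by simp
    show "z \<le> ?s \<bullet> ?u + (P + P') / 2" if z: "z \<in> (\<lambda>x. x \<bullet> ?u) ` ?S" for z
    proof -
      obtain y where "y \<in> ?S" "z = y \<bullet> ?u" using z by blast
      then obtain a b where "a \<in> K" "b \<in> K" "z = (?s + (1/2) *\<^sub>R (a - b)) \<bullet> ?u"
        unfolding S by blast
      then show ?thesis using up(1)[of a] up(2)[of b] by (simp add: inner_add_left inner_diff_left)
    qed
    fix B assume B: "\<And>z. z \<in> (\<lambda>x. x \<bullet> ?u) ` ?S \<Longrightarrow> z \<le> B"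
    have ab: "?s \<bullet> ?u + (a \<bullet> ?u - b \<bullet> ?u) / 2 \<le> B" if "a \<in> K" "b \<in> K" for a b
    proof -
      have "?s + (1/2) *\<^sub>R (a - b) \<in> ?S" unfolding S using that by blast
      from B[OF imageI[OF this]] show ?thesis by (simp add: inner_add_left inner_diff_left)
    qed
    have P_le: "P \<le> 2 * (B - ?s \<bullet> ?u) + b \<bullet> ?u" if "b \<in> K" for b
      unfolding P_def support_fun_def using ab[OF _ that] by (intro cSUP_least[OF assms(2)]) (simp add: field_simps)
    have "- (b \<bullet> ?u) \<le> 2 * (B - ?s \<bullet> ?u) - P" if "b \<in> K" for b using P_le[OF that] by linarith
    then have "P' \<le> 2 * (B - ?s \<bullet> ?u) - P"
      unfolding P'_def support_fun_def by (intro cSUP_least[OF assms(2)]) (simp add: u')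
    then show "?s \<bullet> ?u + (P + P') / 2 \<le> B" by (simp add: field_simps)
  qed
  then show ?thesis
    using support_fun_frontier[OF b ne] support_fun_frontier[OF assms] by (simp add: P_def P'_def)
qed

section \<open>The areas and the inequalities\<close>

lemma wigner_caustic_area_eq:
  assumes d: "\<And>\<theta>. (support_fun M has_real_derivative p' \<theta>) (at \<theta>)"
    "\<And>\<theta>. (p' has_real_derivative p'' \<theta>) (at \<theta>)"
  defines "q \<equiv> \<lambda>\<theta>. (support_fun M \<theta> - support_fun M (\<theta> + pi)) / 2"
    and "q'' \<equiv> \<lambda>\<theta>. (p'' \<theta> - p'' (\<theta> + pi)) / 2"
  shows "wigner_caustic_area M = integral {0..pi} (\<lambda>\<theta>. q \<theta> * (q \<theta> + q'' \<theta>)) / 2"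
proof -
  define q' where "q' = (\<lambda>\<theta>. (p' \<theta> - p' (\<theta> + pi)) / 2)"
  have sh: "((\<lambda>\<theta>. h (\<theta> + pi)) has_real_derivative h' (\<theta> + pi)) (at \<theta>)"
    if "\<And>\<theta>. (h has_real_derivative h' \<theta>) (at \<theta>)" for h h' :: "real \<Rightarrow> real" and \<theta>
    using DERIV_shift that by blast
  have dq: "(q has_real_derivative q' \<theta>) (at \<theta>)" "(q' has_real_derivative q'' \<theta>) (at \<theta>)" for \<theta>
    unfolding q_def q'_def q''_def by (intro DERIV_cdivide DERIV_diff d sh)+
  have "wigner_caustic M = support_curve q"
    unfolding support_curve_deriv(1)[OF dq] wigner_caustic_def[abs_def] oval_curve_def support_curve_deriv(1)[OF d]
    by (simp add: fun_eq_iff q_def q'_def field_simps)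
  then show ?thesis
    unfolding wigner_caustic_area_def by (simp add: oriented_area_support_curve[OF dq])
qed

lemma sms_area_eq:
  assumes d: "\<And>\<theta>. (support_fun M has_real_derivative p' \<theta>) (at \<theta>)"
    "\<And>\<theta>. (p' has_real_derivative p'' \<theta>) (at \<theta>)"
  defines "q \<equiv> \<lambda>\<theta>. support_fun M \<theta> - oval_length M / (2 * pi)"
  shows "sms_area M = integral {0..2 * pi} (\<lambda>\<theta>. q \<theta> * (q \<theta> + p'' \<theta>)) / 2"
proof -
  have dq: "(q has_real_derivative p' \<theta>) (at \<theta>)" for \<theta>
    unfolding q_def by (auto intro!: derivative_eq_intros d)
  have "spherical_measure_set M = support_curve q"
    unfolding support_curve_deriv(1)[OF dq d(2)] spherical_measure_set_def[abs_def] oval_curve_def support_curve_deriv(1)[OF d]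
    by (simp add: fun_eq_iff q_def unit_dir_def algebra_simps)
  then show ?thesis
    unfolding sms_area_def by (simp add: oriented_area_support_curve[OF dq d(2)])
qed

theorem corollary6p12:
  fixes K :: "plane set"
  assumes "strictly_convex_domain K"
    and "oval (frontier K)"
  shows "\<bar>wigner_caustic_area (frontier K)\<bar>
           \<ge> max (pi * (dist_inf K (steiner_symmetral K))\<^sup>2)
                 (2 * (dist_2 K (steiner_symmetral K))\<^sup>2)
       \<and> (\<forall>W. \<not> constant_width (frontier K) \<and>
              oval_param (wigner_type_curve (frontier K)) (2 * pi) \<and>
              convex_body W \<and> frontier W = range (wigner_type_curve (frontier K)) \<longrightarrow>
            \<bar>sms_area (frontier K)\<bar>
              \<ge> Max {2 * pi * (dist_inf K (steiner_symmetral K))\<^sup>2 + pi * (dist_inf K W)\<^sup>2,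
                     2 * pi * (dist_inf K (steiner_symmetral K))\<^sup>2 + 3 / 2 * (dist_2 K W)\<^sup>2,
                     4 * (dist_2 K (steiner_symmetral K))\<^sup>2 + pi * (dist_inf K W)\<^sup>2,
                     4 * (dist_2 K (steiner_symmetral K))\<^sup>2 + 3 / 2 * (dist_2 K W)\<^sup>2})"
proof -
  let ?M = "frontier K" and ?S = "steiner_symmetral K"
  define p where "p = support_fun ?M"
  define L where "L = oval_length ?M"
  obtain p' p'' where d: "\<And>\<theta>. (p has_real_derivative p' \<theta>) (at \<theta>)" "\<And>\<theta>. (p' has_real_derivative p'' \<theta>) (at \<theta>)"
    and c'': "continuous_on UNIV p''" and L: "L = integral {0..2 * pi} p" "L > 0"
    using oval_support_fun[OF assms(2)] unfolding p_def L_def by metis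
  have bK: "bounded K" "K \<noteq> {}" using assms(1) interior_subset unfolding strictly_convex_domain_def by auto
  have c': "continuous_on X p'" and cp: "continuous_on X p" for X
    using d by (meson DERIV_isCont continuous_at_imp_continuous_on)+
  have per: "p (\<theta> + 2 * pi) = p \<theta>" for \<theta> unfolding p_def by (rule support_fun_periodic)
  have per': "p' (\<theta> + 2 * pi) = p' \<theta>" for \<theta> using derivative_shift[OF d(1), of "2 * pi" 1] per by simp
  have per'': "p'' (\<theta> + 2 * pi) = p'' \<theta>" for \<theta> using derivative_shift[OF d(2), of "2 * pi" 1] per' by simp

  define sx sy where "sx = fst (steiner_point K)" and "sy = snd (steiner_point K)"
  define s where "s = (\<lambda>\<theta>. sx * cos \<theta> + sy * sin \<theta>)"
  define s' where "s' = (\<lambda>\<theta>. - sx * sin \<theta> + sy * cos \<theta>)"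
  have ds: "(s has_real_derivative s' \<theta>) (at \<theta>)" "(s' has_real_derivative - s \<theta>) (at \<theta>)" for \<theta>
    unfolding s_def s'_def by (auto intro!: derivative_eq_intros)
  have s_shift: "s (\<theta> + pi) = - s \<theta>" for \<theta> by (simp add: s_def)
  have s_inner: "steiner_point K \<bullet> unit_dir \<theta> = s \<theta>" for \<theta>
    by (simp add: s_def sx_def sy_def unit_dir_def inner_prod_def)

  define odd odd'' where "odd = (\<lambda>\<theta>. (p \<theta> - p (\<theta> + pi)) / 2)" and "odd'' = (\<lambda>\<theta>. (p'' \<theta> - p'' (\<theta> + pi)) / 2)"
  define odd' where "odd' = (\<lambda>\<theta>. (p' \<theta> - p' (\<theta> + pi)) / 2)"
  define f f' f'' where "f = (\<lambda>\<theta>. odd \<theta> - s \<theta>)" and "f' = (\<lambda>\<theta>. odd' \<theta> - s' \<theta>)" and "f'' = (\<lambda>\<theta>. odd'' \<theta> + s \<theta>)"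
  define g where "g = (\<lambda>\<theta>. (p \<theta> + p (\<theta> + pi)) / 2 - L / (2 * pi))"
  define g' g'' where "g' = (\<lambda>\<theta>. (p' \<theta> + p' (\<theta> + pi)) / 2)" and "g'' = (\<lambda>\<theta>. (p'' \<theta> + p'' (\<theta> + pi)) / 2)"
  have sh: "((\<lambda>\<theta>. h (\<theta> + pi)) has_real_derivative h' (\<theta> + pi)) (at \<theta>)"
    if "\<And>\<theta>. (h has_real_derivative h' \<theta>) (at \<theta>)" for h h' :: "real \<Rightarrow> real" and \<theta>
    using DERIV_shift that by blast
  have dodd: "(odd has_real_derivative odd' \<theta>) (at \<theta>)" "(odd' has_real_derivative odd'' \<theta>) (at \<theta>)" for \<theta>
    unfolding odd_def odd'_def odd''_def by (intro DERIV_cdivide DERIV_diff d sh)+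
  have df: "(f has_real_derivative f' \<theta>) (at \<theta>)" "(f' has_real_derivative f'' \<theta>) (at \<theta>)" for \<theta>
    unfolding f_def f'_def f''_def using DERIV_diff[OF dodd(1) ds(1)] DERIV_diff[OF dodd(2) ds(2)] by simp_all
  have dg: "(g has_real_derivative g' \<theta>) (at \<theta>)" "(g' has_real_derivative g'' \<theta>) (at \<theta>)" for \<theta>
  proof -
    show "(g has_real_derivative g' \<theta>) (at \<theta>)"
      unfolding g_def g'_def
      using DERIV_diff[OF DERIV_cdivide[OF DERIV_add[OF d(1) sh[OF d(1)]]] DERIV_const] by simp
    show "(g' has_real_derivative g'' \<theta>) (at \<theta>)"
      unfolding g'_def g''_def by (rule DERIV_cdivide[OF DERIV_add[OF d(2) sh[OF d(2)]]])
  qed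
  have csh: "continuous_on UNIV (\<lambda>\<theta>. h (\<theta> + pi))" if "continuous_on UNIV h" for h :: "real \<Rightarrow> real"
    by (rule continuous_on_compose2[OF that]) (auto intro!: continuous_intros)
  have cs: "continuous_on UNIV s" unfolding s_def by (intro continuous_intros)
  have codd: "continuous_on UNIV odd" "continuous_on UNIV odd''"
    unfolding odd_def odd''_def by (intro continuous_intros csh cp c''; simp)+
  have cf: "continuous_on UNIV f" "continuous_on UNIV f''"
    unfolding f_def f''_def by (intro continuous_intros codd cs)+
  have cg: "continuous_on UNIV g" "continuous_on UNIV g''"
    unfolding g_def g''_def by (intro continuous_intros csh cp c''; simp)+
  have cf': "continuous_on UNIV f'" and cg': "continuous_on UNIV g'"
    using df dg by (meson DERIV_isCont continuous_at_imp_continuous_on)+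

  have two: "\<theta> + pi + pi = \<theta> + 2 * pi" for \<theta> :: real by simp
  have sym_odd: "odd (\<theta> + pi) = - odd \<theta>" "odd'' (\<theta> + pi) = - odd'' \<theta>" for \<theta>
    unfolding odd_def odd''_def two per per'' by (simp_all add: field_simps)
  have sym_f: "f (\<theta> + pi) = - f \<theta>" "f'' (\<theta> + pi) = - f'' \<theta>" for \<theta>
    unfolding f_def f''_def sym_odd s_shift by simp_all
  have sym_g: "g (\<theta> + pi) = g \<theta>" "g'' (\<theta> + pi) = g'' \<theta>" for \<theta>
    unfolding g_def g''_def two per per'' by (simp_all add: add.commute)
  have decomp: "p \<theta> = f \<theta> + s \<theta> + g \<theta> + L / (2 * pi)" for \<theta>
    unfolding f_def odd_def g_def by (simp add: field_simps)
  have decomp'': "p'' \<theta> = f'' \<theta> - s \<theta> + g'' \<theta>" for \<theta>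
    unfolding f''_def odd''_def g''_def by (simp add: field_simps)
  \<comment> \<open>The defining integral of the Steiner point says that \<open>s\<close> is the first harmonic of \<open>p\<close>, and
     Cauchy's formula that \<open>L / (2 * pi)\<close> is its mean. So \<open>f\<close> and \<open>g\<close> are free of both.\<close>
  have int_p: "(p has_integral L) {0..2 * pi}"
    unfolding L(1) by (intro integrable_integral integrable_continuous_real cp)
  have int_f: "(f has_integral 0) {0..2 * pi}" and int_s: "(s has_integral 0) {0..2 * pi}"
    by (intro has_integral_antiperiodic cf cs sym_f s_shift)+
  have int_g: "(g has_integral 0) {0..2 * pi}"
  proof -
    have "((\<lambda>\<theta>. p \<theta> - f \<theta> - s \<theta> - L / (2 * pi)) has_integral L - 0 - 0 - L) {0..2 * pi}"
      by (intro has_integral_diff int_p int_f int_s)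
         (use has_integral_const_real[of "L / (2 * pi)" 0 "2 * pi"] in simp)
    moreover have "p \<theta> - f \<theta> - s \<theta> - L / (2 * pi) = g \<theta>" for \<theta> using decomp[of \<theta>] by simp
    ultimately show ?thesis by simp
  qed
  have int_gc: "((\<lambda>\<theta>. g \<theta> * cos \<theta>) has_integral 0) {0..2 * pi}"
    and int_gs: "((\<lambda>\<theta>. g \<theta> * sin \<theta>) has_integral 0) {0..2 * pi}"
    by (intro has_integral_antiperiodic continuous_intros cg; simp add: sym_g)+
  have int_pu: "((\<lambda>\<theta>. p \<theta> *\<^sub>R unit_dir \<theta>) has_integral pi *\<^sub>R steiner_point K) {0..2 * pi}"
  proof -
    have "(\<lambda>\<theta>. p \<theta> *\<^sub>R unit_dir \<theta>) integrable_on {0..2 * pi}"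
      unfolding unit_dir_def by (intro integrable_continuous_real continuous_intros cp)
    then show ?thesis unfolding steiner_point_def p_def by (simp add: integrable_integral)
  qed
  have int_pc: "((\<lambda>\<theta>. p \<theta> * cos \<theta>) has_integral pi * sx) {0..2 * pi}"
    and int_ps: "((\<lambda>\<theta>. p \<theta> * sin \<theta>) has_integral pi * sy) {0..2 * pi}"
    using has_integral_linear[OF int_pu bounded_linear_fst] has_integral_linear[OF int_pu bounded_linear_snd]
    by (simp_all add: o_def unit_dir_def sx_def sy_def)
  have cc: "((\<lambda>\<theta>. cos \<theta> * cos \<theta>) has_integral pi) {0..2 * pi}" "((\<lambda>\<theta>. sin \<theta> * sin \<theta>) has_integral pi) {0..2 * pi}"
    "((\<lambda>\<theta>. cos \<theta> * sin \<theta>) has_integral 0) {0..2 * pi}" "((\<lambda>\<theta>. sin \<theta> * cos \<theta>) has_integral 0) {0..2 * pi}"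
    using has_integral_trig_products[of 1 1] by simp_all
  have int_c: "(cos has_integral 0) {0..2 * pi}" and int_sin: "(sin has_integral 0) {0..2 * pi}"
    by (intro has_integral_antiperiodic continuous_intros; simp)+
  have int_fc: "((\<lambda>\<theta>. f \<theta> * cos \<theta>) has_integral 0) {0..2 * pi}"
  proof -
    have "((\<lambda>\<theta>. p \<theta> * cos \<theta> - g \<theta> * cos \<theta> - (sx * (cos \<theta> * cos \<theta>) + sy * (sin \<theta> * cos \<theta>)) - L / (2 * pi) * cos \<theta>)
        has_integral pi * sx - 0 - (sx * pi + sy * 0) - L / (2 * pi) * 0) {0..2 * pi}"
      by (intro has_integral_diff has_integral_add has_integral_mult_right int_pc int_gc cc int_c)
    moreover have "p \<theta> * cos \<theta> - g \<theta> * cos \<theta> - (sx * (cos \<theta> * cos \<theta>) + sy * (sin \<theta> * cos \<theta>)) - L / (2 * pi) * cos \<theta>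
       = f \<theta> * cos \<theta>" for \<theta>
      unfolding decomp s_def by (simp add: algebra_simps)
    ultimately show ?thesis by simp
  qed
  have int_fs: "((\<lambda>\<theta>. f \<theta> * sin \<theta>) has_integral 0) {0..2 * pi}"
  proof -
    have "((\<lambda>\<theta>. p \<theta> * sin \<theta> - g \<theta> * sin \<theta> - (sx * (cos \<theta> * sin \<theta>) + sy * (sin \<theta> * sin \<theta>)) - L / (2 * pi) * sin \<theta>)
        has_integral pi * sy - 0 - (sx * 0 + sy * pi) - L / (2 * pi) * 0) {0..2 * pi}"
      by (intro has_integral_diff has_integral_add has_integral_mult_right int_ps int_gs cc int_sin)
    moreover have "p \<theta> * sin \<theta> - g \<theta> * sin \<theta> - (sx * (cos \<theta> * sin \<theta>) + sy * (sin \<theta> * sin \<theta>)) - L / (2 * pi) * sin \<theta>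
       = f \<theta> * sin \<theta>" for \<theta>
      unfolding decomp s_def by (simp add: algebra_simps)
    ultimately show ?thesis by simp
  qed
  interpret F: symmetric_orthogonal f f' 3
    by unfold_locales (use df(1) cf' sym_f(1) int_f int_fc int_fs in simp_all)
  interpret G: symmetric_orthogonal g g' 2
    by unfold_locales (use dg(1) cg' sym_g(1) int_g int_gc int_gs in simp_all)

  note A = F.integral_area_form[OF df(2)] and B = G.integral_area_form[OF dg(2)]
  have SF: "((\<lambda>\<theta>. s \<theta> * (f \<theta> + f'' \<theta>)) has_integral 0) {0..2 * pi}"
    and SG: "((\<lambda>\<theta>. s \<theta> * (g \<theta> + g'' \<theta>)) has_integral 0) {0..2 * pi}"
    unfolding s_def by (rule F.integral_translation_form[OF df(2)] G.integral_translation_form[OF dg(2)])+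

  \<comment> \<open>The support function of the Wigner caustic is \<open>odd = f + s\<close>. Half a period suffices to run
     through the curve, whence the factor \<open>1/4\<close>.\<close>
  have wigner: "wigner_caustic_area ?M = - F.energy / 4"
  proof -
    have "wigner_caustic_area ?M = integral {0..pi} (\<lambda>\<theta>. odd \<theta> * (odd \<theta> + odd'' \<theta>)) / 2"
      using wigner_caustic_area_eq[OF d[unfolded p_def]] by (simp add: odd_def odd''_def p_def)
    also have "integral {0..pi} (\<lambda>\<theta>. odd \<theta> * (odd \<theta> + odd'' \<theta>)) =
        integral {0..2 * pi} (\<lambda>\<theta>. odd \<theta> * (odd \<theta> + odd'' \<theta>)) / 2"
      by (intro integral_half_period continuous_intros codd) (simp add: sym_odd algebra_simps)
    also have "(\<lambda>\<theta>. odd \<theta> * (odd \<theta> + odd'' \<theta>)) = (\<lambda>\<theta>. f \<theta> * (f \<theta> + f'' \<theta>) + s \<theta> * (f \<theta> + f'' \<theta>))"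
      by (simp add: f_def f''_def fun_eq_iff algebra_simps)
    also have "integral {0..2 * pi} \<dots> = - F.energy"
      using has_integral_add[OF A SF] by (simp add: integral_unique)
    finally show ?thesis by simp
  qed

  \<comment> \<open>The support function of the Spherical Measure Set is \<open>f + s + g\<close>; the mixed terms of \<open>f\<close> and \<open>g\<close>
     are antiperiodic with respect to \<open>pi\<close>.\<close>
  have sms: "sms_area ?M = - (F.energy + G.energy) / 2"
  proof -
    have cross: "((\<lambda>\<theta>. f \<theta> * (g \<theta> + g'' \<theta>) + g \<theta> * (f \<theta> + f'' \<theta>)) has_integral 0) {0..2 * pi}"
      by (intro has_integral_antiperiodic continuous_intros cf cg) (simp add: sym_f sym_g algebra_simps)
    have "sms_area ?M = integral {0..2 * pi} (\<lambda>\<theta>. (p \<theta> - L / (2 * pi)) * (p \<theta> - L / (2 * pi) + p'' \<theta>)) / 2"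
      using sms_area_eq[OF d[unfolded p_def]] by (simp add: p_def L_def)
    also have "(\<lambda>\<theta>. (p \<theta> - L / (2 * pi)) * (p \<theta> - L / (2 * pi) + p'' \<theta>)) =
      (\<lambda>\<theta>. f \<theta> * (f \<theta> + f'' \<theta>) + g \<theta> * (g \<theta> + g'' \<theta>) + (s \<theta> * (f \<theta> + f'' \<theta>) + s \<theta> * (g \<theta> + g'' \<theta>))
         + (f \<theta> * (g \<theta> + g'' \<theta>) + g \<theta> * (f \<theta> + f'' \<theta>)))"
      unfolding decomp decomp'' by (simp add: fun_eq_iff algebra_simps)
    also have "integral {0..2 * pi} \<dots> = - F.energy + - G.energy + (0 + 0) + 0"
      by (intro integral_unique has_integral_add A B SF SG cross)
    finally show ?thesis by simp
  qed

  have pS: "support_fun ?M \<theta> - support_fun (frontier ?S) \<theta> = f \<theta>" for \<theta>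
    unfolding support_fun_steiner_symmetral[OF bK] s_inner p_def[symmetric] f_def odd_def
    by (simp add: field_simps)
  have S_inf: "4 * pi * (dist_inf K ?S)\<^sup>2 \<le> F.energy" using F.dist_inf_bound[OF pS] by simp
  have S_2: "8 * (dist_2 K ?S)\<^sup>2 \<le> F.energy" using F.dist_2_bound[OF pS] by simp

  show ?thesis
  proof (intro conjI allI impI)
    show "\<bar>wigner_caustic_area ?M\<bar> \<ge> max (pi * (dist_inf K ?S)\<^sup>2) (2 * (dist_2 K ?S)\<^sup>2)"
      using S_inf S_2 F.energy_nonneg unfolding wigner by simp
  next
    fix W
    assume W: "\<not> constant_width ?M \<and> oval_param (wigner_type_curve ?M) (2 * pi) \<and>
              convex_body W \<and> frontier W = range (wigner_type_curve ?M)"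
    define h where "h = (\<lambda>\<theta>. L / (2 * pi) + odd \<theta>)"
    have wt: "wigner_type_curve ?M = support_curve h"
      unfolding wigner_type_curve_def h_def odd_def p_def L_def ..
    have dh: "(h has_real_derivative odd' \<theta>) (at \<theta>)" for \<theta>
      unfolding h_def by (auto intro!: derivative_eq_intros dodd)
    have "h \<theta> + h (\<theta> + pi) > 0" for \<theta> using L(2) by (simp add: h_def sym_odd)
    from support_fun_support_curve[OF dh dodd(2) this] W
    have "support_fun (frontier W) = h" by (simp add: wt)
    then have pW: "support_fun ?M \<theta> - support_fun (frontier W) \<theta> = g \<theta>" for \<theta>
      unfolding h_def p_def[symmetric] g_def odd_def by (simp add: field_simps)
    have W_inf: "2 * pi * (dist_inf K W)\<^sup>2 \<le> G.energy" using G.dist_inf_bound[OF pW] by simp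
    have W_2: "3 * (dist_2 K W)\<^sup>2 \<le> G.energy" using G.dist_2_bound[OF pW] by simp
    have "\<bar>sms_area ?M\<bar> = (F.energy + G.energy) / 2"
      unfolding sms using F.energy_nonneg G.energy_nonneg by simp
    then show "\<bar>sms_area ?M\<bar>
              \<ge> Max {2 * pi * (dist_inf K ?S)\<^sup>2 + pi * (dist_inf K W)\<^sup>2,
                     2 * pi * (dist_inf K ?S)\<^sup>2 + 3 / 2 * (dist_2 K W)\<^sup>2,
                     4 * (dist_2 K ?S)\<^sup>2 + pi * (dist_inf K W)\<^sup>2,
                     4 * (dist_2 K ?S)\<^sup>2 + 3 / 2 * (dist_2 K W)\<^sup>2}"
      using S_inf S_2 W_inf W_2 by (intro Max.boundedI) auto
  qed
qed

end
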